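(* Let $T$ be an aperiodic interval exchange transformation of $X=[0,1)$ associated to the permutation $\sigma$ and to the partition $\xi$. Then for $\mu$-almost all $x\in X$, where $\mu$ denotes the Lebesgue measure, $AIC(x,n)\approx\text{constant}$, where the AIC is considered with respect to the partition $\xi$.
   Context: Interval exchange transformation: let $\xi=\{I_1,\dots,I_r\}$, $r\ge2$, be a partition of $X=[0,1)$ into half-open intervals (closed on the left), numbered from left to right, and $\sigma=(\sigma_1,\dots,\sigma_r)$ a permutation of $(1,\dots,r)$. On each $I_i$ the map $T$ acts as a translation $x\mapsto x+\alpha_i$ with $\alpha_i=\sum_{k<\sigma^{-1}(i)}|I_{\sigma_k}|-\sum_{k<i}|I_k|$, so that the images $I_i'=TI_i$ are ordered from left to right as $I'_{\sigma_1},\dots,I'_{\sigma_r}$. $T$ is aperiodic if it has no periodic points. Algorithmic information content: let $M_1,M_2,\dots$ be a computable enumeration of the Turing machines and $e_n$ the $n$-th binary string in lexicographical order $0,1,00,01,\dots$. Fix a universal Turing machine $U$, i.e. one with $U(\hat e_n p)=M_n(p)$ for all $n$ and all finite binary strings $p$, where for a word $q$ of length $m$, $\hat q=q(0)q(0)q(1)q(1)\cdots q(m-1)q(m-1)01$. For a finite string $s$ over a finite alphabet, $AIC_U(s)=\min\{\ell(p):U(p)=s\}$ over finite binary strings $p$, with $\ell(p)$ the length of $p$ (and $\infty$ if there is no such $p$). With $\omega_j\in\{1,\dots,r\}$ defined by $T^jx\in I_{\omega_j}$, put $AIC(x,n)=AIC_U(\omega_0\cdots\omega_{n-1})$. For sequences,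 $a_n\approx b_n$ means that for every $\epsilon>0$, $a_n/b_n=o(n^\epsilon)$ and $b_n/a_n=o(n^\epsilon)$ as $n\to\infty$. *)

theory Defs
  imports "HOL-Analysis.Analysis" "HOL-Combinatorics.Permutations"
    "HOL-Library.Landau_Symbols" "HOL-Library.Extended_Nat"
begin

section \<open>Interval exchange transformations\<close>

definition interval_partition :: "nat \<Rightarrow> (nat \<Rightarrow> real set) \<Rightarrow> bool" where
  "interval_partition r I \<longleftrightarrow>
     (\<forall>i\<in>{1..r}. \<exists>a b. a < b \<and> I i = {a..<b}) \<and>
     disjoint_family_on I {1..r} \<and>
     (\<Union>i\<in>{1..r}. I i) = {0..<1} \<and>
     (\<forall>i\<in>{1..r}. \<forall>j\<in>{1..r}. i < j \<longrightarrow> (\<forall>x\<in>I i. \<forall>y\<in>I j. x < y))"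

definition translation :: "(nat \<Rightarrow> real set) \<Rightarrow> (nat \<Rightarrow> nat) \<Rightarrow> nat \<Rightarrow> real" where
  "translation I \<sigma> i =
     (\<Sum>k\<in>{1..<inv \<sigma> i}. measure lborel (I (\<sigma> k))) - (\<Sum>k\<in>{1..<i}. measure lborel (I k))"

text \<open>Only the restriction of \<open>T\<close> to \<open>{0..<1}\<close> is meaningful.\<close>

definition interval_exchange ::
  "nat \<Rightarrow> (nat \<Rightarrow> real set) \<Rightarrow> (nat \<Rightarrow> nat) \<Rightarrow> (real \<Rightarrow> real) \<Rightarrow> bool" where
  "interval_exchange r I \<sigma> T \<longleftrightarrow>
     interval_partition r I \<and> \<sigma> permutes {1..r} \<and>
     (\<forall>i\<in>{1..r}. \<forall>x\<in>I i. T x = x + translation I \<sigma> i)"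

definition aperiodic :: "(real \<Rightarrow> real) \<Rightarrow> bool" where
  "aperiodic T \<longleftrightarrow> \<not> (\<exists>x\<in>{0..<1}. \<exists>n\<ge>1. (T ^^ n) x = x)"

definition coding :: "nat \<Rightarrow> (nat \<Rightarrow> real set) \<Rightarrow> (real \<Rightarrow> real) \<Rightarrow> real \<Rightarrow> nat \<Rightarrow> nat" where
  "coding r I T x j = (THE i. i \<in> {1..r} \<and> (T ^^ j) x \<in> I i)"

definition coding_word ::
  "nat \<Rightarrow> (nat \<Rightarrow> real set) \<Rightarrow> (real \<Rightarrow> real) \<Rightarrow> real \<Rightarrow> nat \<Rightarrow> nat list" where
  "coding_word r I T x n = map (coding r I T x) [0..<n]"

section \<open>Turing machines\<close>

text \<open>
  Deterministic machines with one two-way infinite tape. A machine is a finite partial map from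
  (state, scanned symbol) to (new state, written symbol, move); it starts in state 0 on cell 0 and
  halts when the map is undefined. Inputs are binary words (\<open>Bit\<close>), outputs are words
  over \<open>{1..r}\<close> (\<open>Letter\<close>); \<open>Aux\<close> supplies auxiliary tape symbols.
\<close>

datatype sym = Blank | Bit bool | Letter nat | Aux nat

datatype move = Left | Stay | Right

type_synonym tm = "nat \<times> sym \<Rightarrow> (nat \<times> sym \<times> move) option"

type_synonym config = "nat \<times> int \<times> (int \<Rightarrow> sym)"

definition sym_ok :: "nat \<Rightarrow> sym \<Rightarrow> bool" where
  "sym_ok r s \<longleftrightarrow> (\<forall>a. s = Letter a \<longrightarrow> a \<in> {1..r})"

text \<open>
  The output alphabet has to be the same finite set for all machines: a single machine could not
  reproduce the outputs of machines with arbitrarily large output alphabets, so that no universal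
  machine would exist.
\<close>

definition turing_machines :: "nat \<Rightarrow> tm set" where
  "turing_machines r =
     {M. finite (dom M) \<and>
         (\<forall>q a q' b d. M (q, a) = Some (q', b, d) \<longrightarrow> sym_ok r a \<and> sym_ok r b)}"

fun shift :: "move \<Rightarrow> int \<Rightarrow> int" where
  "shift Left i = i - 1"
| "shift Stay i = i"
| "shift Right i = i + 1"

inductive tm_step :: "tm \<Rightarrow> config \<Rightarrow> config \<Rightarrow> bool" for M where
  "M (q, t i) = Some (q', b, d) \<Longrightarrow> tm_step M (q, i, t) (q', shift d i, t(i := b))"

definition initial_config :: "bool list \<Rightarrow> config" where
  "initial_config p =
     (0, 0, \<lambda>i. if 0 \<le> i \<and> i < int (length p) then Bit (p ! nat i) else Blank)"

text \<open>The output is the longest word of letters on the halting tape that starts in cell 0.\<close>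

definition computes :: "tm \<Rightarrow> bool list \<Rightarrow> nat list \<Rightarrow> bool" where
  "computes M p s \<longleftrightarrow>
     (\<exists>q i t. (tm_step M)\<^sup>*\<^sup>* (initial_config p) (q, i, t) \<and> M (q, t i) = None \<and>
        (\<forall>j<length s. t (int j) = Letter (s ! j)) \<and> (\<forall>a. t (int (length s)) \<noteq> Letter a))"

section \<open>Computable enumerations and universal machines\<close>

text \<open>
  The \<open>n\<close>-th word (\<open>n \<ge> 1\<close>) of the list 0, 1, 00, 01, 10, 11, 000, \<dots> is the binary
  expansion of \<open>n + 1\<close> without its leading digit.
\<close>

fun bin_string :: "nat \<Rightarrow> bool list" where
  "bin_string 0 = []"
| "bin_string (Suc n) = bin_string (n div 2) @ [odd n]"

lemma bin_string_examples:
  "map bin_string [1, 2, 3, 4, 5, 6, 7] =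
     [[False], [True], [False, False], [False, True], [True, False], [True, True],
      [False, False, False]]"
  by code_simp

definition hat :: "bool list \<Rightarrow> bool list" where
  "hat q = concat (map (\<lambda>b. [b, b]) q) @ [False, True]"

text \<open>
  Machine tables are written as words over the letters 1 and 2, which belong to every output
  alphabet considered here (\<open>r \<ge> 2\<close>); numbers are written in self-delimiting unary.
\<close>

definition encode_nat :: "nat \<Rightarrow> nat list" where
  "encode_nat n = replicate n 2 @ [1]"

fun encode_sym :: "sym \<Rightarrow> nat list" where
  "encode_sym Blank = encode_nat 0"
| "encode_sym (Bit b) = encode_nat (if b then 2 else 1)"
| "encode_sym (Letter a) = encode_nat 3 @ encode_nat a"
| "encode_sym (Aux a) = encode_nat 4 @ encode_nat a"

fun encode_move :: "move \<Rightarrow> nat list" where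
  "encode_move Left = encode_nat 0"
| "encode_move Stay = encode_nat 1"
| "encode_move Right = encode_nat 2"

fun encode_instr :: "(nat \<times> sym) \<times> (nat \<times> sym \<times> move) \<Rightarrow> nat list" where
  "encode_instr ((q, a), (q', b, d)) =
     encode_nat q @ encode_sym a @ encode_nat q' @ encode_sym b @ encode_move d"

definition is_code :: "tm \<Rightarrow> nat list \<Rightarrow> bool" where
  "is_code M w \<longleftrightarrow>
     (\<exists>table. distinct (map fst table) \<and> map_of table = M \<and> w = concat (map encode_instr table))"

text \<open>Enumerations are indexed from 1; the value at 0 is irrelevant.\<close>

definition computable_enumeration :: "nat \<Rightarrow> (nat \<Rightarrow> tm) \<Rightarrow> bool" where
  "computable_enumeration r M \<longleftrightarrow>
     M ` {1..} = turing_machines r \<and>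
     (\<exists>C\<in>turing_machines r. \<forall>n\<ge>1. \<exists>w. is_code (M n) w \<and> computes C (bin_string n) w)"

text \<open>The equivalence says that both sides agree as partial functions.\<close>

definition universal :: "nat \<Rightarrow> (nat \<Rightarrow> tm) \<Rightarrow> tm \<Rightarrow> bool" where
  "universal r M U \<longleftrightarrow>
     U \<in> turing_machines r \<and>
     (\<forall>n\<ge>1. \<forall>p s. computes U (hat (bin_string n) @ p) s \<longleftrightarrow> computes (M n) p s)"

section \<open>Algorithmic information content\<close>

definition AIC :: "tm \<Rightarrow> nat list \<Rightarrow> enat" where
  "AIC U s = Inf {enat (length p) |p. computes U p s}"

text \<open>
  The first condition makes the two quotients meaningful; without it, division by zero would
  silently count as zero.
\<close>

definition same_order :: "(nat \<Rightarrow> real) \<Rightarrow> (nat \<Rightarrow> real) \<Rightarrow> bool" where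
  "same_order a b \<longleftrightarrow>
     (\<forall>\<^sub>F n in sequentially. a n \<noteq> 0 \<and> b n \<noteq> 0) \<and>
     (\<forall>\<epsilon>>0. (\<lambda>n. a n / b n) \<in> o(\<lambda>n. real n powr \<epsilon>) \<and> (\<lambda>n. b n / a n) \<in> o(\<lambda>n. real n powr \<epsilon>))"

end

theory Submission
  imports Defs "HOL-Library.Countable"
begin

text \<open>The bound holds for every \<open>x\<close>. Since every point of the orbit is \<open>x\<close> plus a sum of translations,
  a word of length \<open>n\<close> is the itinerary of \<open>x\<close> iff \<open>x\<close>, the translations and the
  breakpoints satisfy a system of homogeneous linear inequalities whose integer coefficients are
  bounded by \<open>n + 1\<close>. Such a system has an integer solution of size polynomial in \<open>n\<close>, so the word
  is also the itinerary of an integer point under an integer system described by \<open>O(log n)\<close> bits, which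
  a fixed Turing machine can simulate. By aperiodicity \<open>T\<^sup>n x\<close> differs from the earlier points of the
  orbit, so the value corresponding to it tells the machine when to stop. Conversely, only one
  \<open>n\<close> can have information content 0, because the empty program has only one output.\<close>

section \<open>Small integer solutions of linear inequalities\<close>

text \<open>Rounding the data would not do: orbit points can lie arbitrarily close to breakpoints,
  so the precision needed to follow an orbit for \<open>n\<close> steps is not controlled by
  \<open>n\<close>. The itinerary, however, depends only on how finitely many linear forms compare
  with one another, and that order can be realised by integers that need not approximate the data at
  all. The unknowns are the starting point, \<open>r\<close> translations and \<open>r - 1\<close>
  breakpoints, hence \<open>2 * r\<close> in number whatever \<open>n\<close> is. Each elimination
  step squares the coefficient bound up to a factor; since the number of steps is fixed, the final
  bound stays polynomial in \<open>n\<close>. Only the length of the program counts, not its running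
  time, so the machine may be as slow and simple as convenient: it rereads the whole program for
  every letter. It keeps no counter either; the final position is one more number, compared in the
  same pass as the breakpoints.\<close>

definition sat :: "bool \<Rightarrow> 'a::linordered_idom \<Rightarrow> bool" where
  "sat s v \<longleftrightarrow> 0 \<le> v \<and> (s \<longrightarrow> v \<noteq> 0)"

lemma sat_of_int [simp]: "sat s (real_of_int v) \<longleftrightarrow> sat s v"
  by (simp add: sat_def)

lemma sat_mult_pos: "0 < c \<Longrightarrow> sat s (c * v) \<longleftrightarrow> sat s v"
  by (simp add: sat_def zero_le_mult_iff)

text \<open>One strict summand makes the sum strict; this is how the flag passes through an
  elimination step.\<close>

lemma sat_add: "sat s v \<Longrightarrow> sat s' v' \<Longrightarrow> sat (s \<or> s') (v + v')"
  by (auto simp: sat_def)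

text \<open>One Fourier--Motzkin step: the variable \<open>t = p / q\<close> has to satisfy all the constraints
  \<open>A + c * t \<ge> 0\<close> (or \<open>> 0\<close>), and every lower bound is compatible with every upper bound.\<close>

lemma rational_between:
  fixes S :: "(int \<times> int \<times> bool) set" and M N :: int
  assumes fin: "finite S" and N: "1 \<le> N" and M: "0 \<le> M"
    and bnd: "\<And>A c s. (A, c, s) \<in> S \<Longrightarrow> \<bar>A\<bar> \<le> M \<and> \<bar>c\<bar> \<le> N"
    and zer: "\<And>A s. (A, 0, s) \<in> S \<Longrightarrow> sat s A"
    and pair: "\<And>A c s A' c' s'. (A, c, s) \<in> S \<Longrightarrow> (A', c', s') \<in> S \<Longrightarrow> 0 < c \<Longrightarrow> c' < 0 \<Longrightarrow>
       sat (s \<or> s') (- c' * A + c * A')"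
  shows "\<exists>p q. 0 < q \<and> q \<le> 2 * N\<^sup>2 \<and> \<bar>p\<bar> \<le> 2 * N * M + N \<and> (\<forall>(A, c, s)\<in>S. sat s (q * A + c * p))"
proof -
  define P where "P = {u \<in> S. fst (snd u) > 0}"
  define Q where "Q = {u \<in> S. fst (snd u) < 0}"
  \<comment> \<open>The value of \<open>t\<close> at which the constraint becomes an equality: a
    lower bound for \<open>t\<close> if \<open>c > 0\<close>, an upper bound if
    \<open>c < 0\<close>.\<close>
  define \<rho> where "\<rho> u = - real_of_int (fst u) / real_of_int (fst (snd u))" for u :: "int \<times> int \<times> bool"
  have finP: "finite P" and finQ: "finite Q" using fin by (auto simp: P_def Q_def)
  have N2: "N \<le> 2 * N\<^sup>2" using N using mult_mono[of 1 N N N] by (simp add: power2_eq_square)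
  have pr: "\<rho> u \<le> \<rho> v \<and> (snd (snd u) \<or> snd (snd v) \<longrightarrow> \<rho> u < \<rho> v)" if "u \<in> P" "v \<in> Q" for u v
  proof -
    obtain A c s where u: "u = (A, c, s)" by (cases u)
    obtain A' c' s' where v: "v = (A', c', s')" by (cases v)
    have c: "0 < c" "c' < 0" and S: "(A, c, s) \<in> S" "(A', c', s') \<in> S"
      using that by (auto simp: P_def Q_def u v)
    have "sat (s \<or> s') (real_of_int (- c' * A + c * A'))"
      using pair[OF S c] by (simp only: sat_of_int)
    moreover have "real_of_int (- c' * A + c * A') = (real_of_int (- c' * c)) * (\<rho> v - \<rho> u)"
      using c by (simp add: \<rho>_def u v field_simps)
    moreover have "0 < real_of_int (- c' * c)" using c by (simp add: mult_neg_pos)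
    ultimately have "sat (s \<or> s') (\<rho> v - \<rho> u)" using sat_mult_pos by metis
    thus ?thesis by (auto simp: sat_def u v)
  qed
  have key: "\<forall>(A, c, s)\<in>S. sat s (q * A + c * p)"
    if q: "0 < q"
      and lo: "\<And>u. u \<in> P \<Longrightarrow> \<rho> u \<le> p / q \<and> (snd (snd u) \<longrightarrow> \<rho> u < p / q)"
      and hi: "\<And>u. u \<in> Q \<Longrightarrow> p / q \<le> \<rho> u \<and> (snd (snd u) \<longrightarrow> p / q < \<rho> u)" for p q :: int
  proof safe
    fix A c s assume S: "(A, c, s) \<in> S"
    consider "c = 0" | "c > 0" | "c < 0" by linarith
    thus "sat s (q * A + c * p)"
    proof cases
      case 1 thus ?thesis using zer[of A s] S q by (simp add: sat_mult_pos)
    next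
      case 2
      have "real_of_int (q * A + c * p) = real_of_int (c * q) * (p / q - \<rho> (A, c, s))"
        using 2 q by (simp add: \<rho>_def field_simps)
      moreover have "sat s (p / q - \<rho> (A, c, s))"
        using lo[of "(A, c, s)"] S 2 by (auto simp: P_def sat_def)
      moreover have "0 < real_of_int (c * q)" using 2 q by simp
      ultimately show ?thesis by (metis sat_of_int sat_mult_pos)
    next
      case 3
      have "real_of_int (q * A + c * p) = real_of_int (- c * q) * (\<rho> (A, c, s) - p / q)"
        using 3 q by (simp add: \<rho>_def field_simps)
      moreover have "sat s (\<rho> (A, c, s) - p / q)"
        using hi[of "(A, c, s)"] S 3 by (auto simp: Q_def sat_def)
      moreover have "0 < real_of_int (- c * q)" using 3 q by (simp add: mult_neg_pos)
      ultimately show ?thesis by (metis sat_of_int sat_mult_pos)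
    qed
  qed
  have mx: "\<exists>u\<in>P. \<forall>v\<in>P. \<rho> v \<le> \<rho> u" if "P \<noteq> {}"
    using arg_min_if_finite[OF finP that, of "\<lambda>u. - \<rho> u"] by (metis linorder_not_less neg_less_iff_less)
  have mn: "\<exists>u\<in>Q. \<forall>v\<in>Q. \<rho> u \<le> \<rho> v" if "Q \<noteq> {}"
    using arg_min_if_finite[OF finQ that, of \<rho>] by (meson linorder_not_less)
  have NM: "0 \<le> N * M" using N M by simp
  show ?thesis
  proof (cases "P = {}"; cases "Q = {}")
    assume "P = {}" "Q = {}"
    hence "\<forall>(A, c, s)\<in>S. sat s (1 * A + c * 0)"
      by (intro key) auto
    moreover have "1 \<le> 2 * N\<^sup>2" using N N2 by linarith
    ultimately show ?thesis using NM N by (intro exI[of _ 0] exI[of _ 1]) auto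
  next
    assume "P = {}" "Q \<noteq> {}"
    then obtain A c s where u: "(A, c, s) \<in> Q" and min: "\<forall>v\<in>Q. \<rho> (A, c, s) \<le> \<rho> v" using mn by auto
    have c: "c < 0" and S: "(A, c, s) \<in> S" using u by (auto simp: Q_def)
    \<comment> \<open>With upper bounds only, one less than the smallest of them fulfils the strict
      constraints too. The one-sided cases are the origin of the summand \<open>N\<close> in the
      bound on \<open>p\<close>.\<close>
    have "real_of_int (A + c) / real_of_int (- c) = \<rho> (A, c, s) - 1"
      using c by (simp add: \<rho>_def field_simps)
    hence "\<forall>(A', c', s')\<in>S. sat s' (- c * A' + c' * (A + c))"
      using c \<open>P = {}\<close> min by (intro key) force+
    moreover have "- c \<le> 2 * N\<^sup>2" "\<bar>A + c\<bar> \<le> M + N" "M \<le> N * M"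
      using bnd[OF S] N2 c N M mult_right_mono[of 1 N M] by auto
    ultimately show ?thesis using NM c by (intro exI[of _ "A + c"] exI[of _ "- c"]) auto
  next
    assume "P \<noteq> {}" "Q = {}"
    then obtain A c s where u: "(A, c, s) \<in> P" and max: "\<forall>v\<in>P. \<rho> v \<le> \<rho> (A, c, s)" using mx by auto
    have c: "0 < c" and S: "(A, c, s) \<in> S" using u by (auto simp: P_def)
    have "real_of_int (c - A) / real_of_int c = \<rho> (A, c, s) + 1"
      using c by (simp add: \<rho>_def field_simps)
    hence "\<forall>(A', c', s')\<in>S. sat s' (c * A' + c' * (c - A))"
      using c \<open>Q = {}\<close> max by (intro key) force+
    moreover have "c \<le> 2 * N\<^sup>2" "\<bar>c - A\<bar> \<le> M + N" "M \<le> N * M"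
      using bnd[OF S] N2 c N M mult_right_mono[of 1 N M] by auto
    ultimately show ?thesis using NM c by (intro exI[of _ "c - A"] exI[of _ "c"]) auto
  next
    assume "P \<noteq> {}" "Q \<noteq> {}"
    then obtain A c s A' c' s' where u: "(A, c, s) \<in> P" and v: "(A', c', s') \<in> Q"
      and max: "\<And>w. w \<in> P \<Longrightarrow> \<rho> w \<le> \<rho> (A, c, s)" and min: "\<And>w. w \<in> Q \<Longrightarrow> \<rho> (A', c', s') \<le> \<rho> w"
      using mx mn by (metis prod.exhaust)
    have c: "0 < c" "c' < 0" and S: "(A, c, s) \<in> S" "(A', c', s') \<in> S"
      using u v by (auto simp: P_def Q_def)
    \<comment> \<open>The midpoint of the largest lower and the smallest upper bound; its
      denominator \<open>2 * c * - c'\<close> is the origin of \<open>2 * N\<^sup>2\<close>. If the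
      two bounds coincide, no constraint attaining them is strict.\<close>
    have q: "0 < 2 * c * - c'" using c by (simp add: mult_pos_neg)
    have eq: "real_of_int (A * c' + A' * c) / real_of_int (2 * c * - c') = (\<rho> (A, c, s) + \<rho> (A', c', s')) / 2"
      using c by (simp add: \<rho>_def field_simps)
    have "\<forall>(a, d, s)\<in>S. sat s (2 * c * - c' * a + d * (A * c' + A' * c))"
    proof (rule key[OF q], unfold eq)
      fix w assume "w \<in> P"
      thus "\<rho> w \<le> (\<rho> (A, c, s) + \<rho> (A', c', s')) / 2 \<and>
          (snd (snd w) \<longrightarrow> \<rho> w < (\<rho> (A, c, s) + \<rho> (A', c', s')) / 2)"
        using pr[OF _ v, of w] max[of w] by auto
    next
      fix w assume "w \<in> Q"
      thus "(\<rho> (A, c, s) + \<rho> (A', c', s')) / 2 \<le> \<rho> w \<and>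
          (snd (snd w) \<longrightarrow> (\<rho> (A, c, s) + \<rho> (A', c', s')) / 2 < \<rho> w)"
        using pr[OF u, of w] min[of w] by auto
    qed
    moreover have "c * - c' \<le> N * N"
      using bnd[OF S(1)] bnd[OF S(2)] c N by (intro mult_mono) auto
    hence "2 * c * - c' \<le> 2 * N\<^sup>2" by (simp add: power2_eq_square mult.commute)
    moreover have "\<bar>A * c'\<bar> \<le> M * N" "\<bar>A' * c\<bar> \<le> M * N"
      using bnd[OF S(1)] bnd[OF S(2)] N M by (auto simp: abs_mult intro!: mult_mono)
    hence "\<bar>A * c' + A' * c\<bar> \<le> 2 * N * M + N" using N by (simp add: mult.commute)
    ultimately show ?thesis using q by blast
  qed
qed

text \<open>The real solution \<open>z\<close> only testifies that the system is consistent.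
  Eliminating the last unknown keeps the restriction of \<open>z\<close> a solution, and an integer
  solution of the smaller system is extended by \<open>rational_between\<close>. The order of
  quantifiers matters: \<open>C\<close> and \<open>e\<close> depend on the number \<open>d\<close>
  of unknowns, not on the number of constraints.\<close>

lemma small_integer_solution:
  "\<exists>C e. \<forall>N S z. 1 \<le> N \<longrightarrow> finite S \<longrightarrow>
     (\<forall>(a, s)\<in>S. (\<forall>k<d. \<bar>a k\<bar> \<le> int N) \<and> sat s (\<Sum>k<d. real_of_int (a k) * z k)) \<longrightarrow>
     (\<exists>y :: nat \<Rightarrow> int. (\<forall>(a, s)\<in>S. sat s (\<Sum>k<d. a k * y k)) \<and> (\<forall>k<d. \<bar>y k\<bar> \<le> int (C * N ^ e)))"
proof (induction d)
  case 0
  show ?case by (auto simp: sat_def)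
next
  case (Suc d)
  then obtain C e where IH: "\<forall>N S z. 1 \<le> N \<longrightarrow> finite S \<longrightarrow>
     (\<forall>(a, s)\<in>S. (\<forall>k<d. \<bar>a k\<bar> \<le> int N) \<and> sat s (\<Sum>k<d. real_of_int (a k) * z k)) \<longrightarrow>
     (\<exists>y :: nat \<Rightarrow> int. (\<forall>(a, s)\<in>S. sat s (\<Sum>k<d. a k * y k)) \<and> (\<forall>k<d. \<bar>y k\<bar> \<le> int (C * N ^ e)))"
    by (elim exE)
  \<comment> \<open>With \<open>B = C * (2 * N\<^sup>2) ^ e\<close> bounding the smaller solution,
    the new entries are at most \<open>2 * N\<^sup>2 * B\<close> and
    \<open>2 * d * N\<^sup>2 * B + N\<close>; \<open>C'\<close> covers the sum of both
    bounds.\<close>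
  define C' where "C' = 2 * (d + 1) * C * 2 ^ e + 1"
  show ?case
  proof (rule exI[of _ C'], rule exI[of _ "2 * e + 2"], intro allI impI)
    fix N :: nat and S :: "((nat \<Rightarrow> int) \<times> bool) set" and z :: "nat \<Rightarrow> real"
    assume N: "1 \<le> N" and fin: "finite S" and S: "\<forall>(a, s)\<in>S. (\<forall>k<Suc d. \<bar>a k\<bar> \<le> int N) \<and>
      sat s (\<Sum>k<Suc d. real_of_int (a k) * z k)"
    \<comment> \<open>The multipliers \<open>- a' d\<close> and \<open>a d\<close> are positive for
      the pairs used below and cancel the coefficient of the last unknown.\<close>
    define comb where "comb = (\<lambda>((a, s), (a', s')).
      ((\<lambda>k. - a' d * a k + a d * a' k) :: nat \<Rightarrow> int, s \<or> s'))"
    define S' where "S' = {(a, s) \<in> S. a d = 0} \<union> comb ` ({(a, s) \<in> S. 0 < a d} \<times> {(a, s) \<in> S. a d < 0})"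
    have N2: "N \<le> 2 * N\<^sup>2" using N by (simp add: power2_eq_square)
    have "finite S'" unfolding S'_def by (intro finite_UnI finite_imageI finite_cartesian_product
         finite_subset[OF _ fin]) auto
    moreover have "\<forall>(a, s)\<in>S'. (\<forall>k<d. \<bar>a k\<bar> \<le> int (2 * N\<^sup>2)) \<and> sat s (\<Sum>k<d. real_of_int (a k) * z k)"
    proof (intro ballI, clarify)
      fix a s assume "(a, s) \<in> S'"
      then consider "(a, s) \<in> S" "a d = 0" | b t b' t' where "(b, t) \<in> S" "0 < b d" "(b', t') \<in> S" "b' d < 0"
         "a = (\<lambda>k. - b' d * b k + b d * b' k)" "s = (t \<or> t')"
        by (auto simp: S'_def comb_def)
      thus "(\<forall>k<d. \<bar>a k\<bar> \<le> int (2 * N\<^sup>2)) \<and> sat s (\<Sum>k<d. real_of_int (a k) * z k)"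
      proof cases
        case 1
        have "\<forall>k<d. \<bar>a k\<bar> \<le> int N" using 1 S by auto
        moreover have "int N \<le> int (2 * N\<^sup>2)" using N2 by linarith
        moreover have "sat s (\<Sum>k<d. real_of_int (a k) * z k)" using 1 S by fastforce
        ultimately show ?thesis by force
      next
        case 2
        have b: "\<bar>b k\<bar> \<le> int N" "\<bar>b' k\<bar> \<le> int N" if "k \<le> d" for k using 2 S that by auto
        have "\<bar>a k\<bar> \<le> int (2 * N\<^sup>2)" if "k < d" for k
        proof -
          have "\<bar>b' d * b k\<bar> \<le> int N * int N" "\<bar>b d * b' k\<bar> \<le> int N * int N"
            using b[of k] b[of d] that by (auto simp: abs_mult intro!: mult_mono)
          thus ?thesis by (auto simp: 2 power2_eq_square)
        qed
        moreover have "sat s (\<Sum>k<d. real_of_int (a k) * z k)"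
        proof -
          have "sat t (\<Sum>k<Suc d. real_of_int (b k) * z k)" "sat t' (\<Sum>k<Suc d. real_of_int (b' k) * z k)"
            using 2 S by auto
          hence "sat t (real_of_int (- b' d) * (\<Sum>k<Suc d. real_of_int (b k) * z k))"
             "sat t' (real_of_int (b d) * (\<Sum>k<Suc d. real_of_int (b' k) * z k))"
            using 2 by (simp_all only: sat_mult_pos of_int_0_less_iff neg_0_less_iff_less)
          from sat_add[OF this] show ?thesis
            by (simp add: 2 algebra_simps sum.distrib sum_distrib_left sum_negf sum_subtractf)
        qed
        ultimately show ?thesis by blast
      qed
    qed
    ultimately obtain y where y: "\<forall>(a, s)\<in>S'. sat s (\<Sum>k<d. a k * y k)"
      and yb: "\<And>k. k < d \<Longrightarrow> \<bar>y k\<bar> \<le> int (C * (2 * N\<^sup>2) ^ e)"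
      using IH[rule_format, of "2 * N\<^sup>2" S' z] N by auto
    define B where "B = int (C * (2 * N\<^sup>2) ^ e)"
    \<comment> \<open>Once \<open>y\<close> is substituted, each constraint has the form
      \<open>A + c * t\<close> in the last unknown \<open>t\<close> alone.\<close>
    define R where "R = (\<lambda>(a, s). (\<Sum>k<d. a k * y k, a d, s :: bool)) ` S"
    have "\<exists>p q. 0 < q \<and> q \<le> 2 * (int N)\<^sup>2 \<and> \<bar>p\<bar> \<le> 2 * int N * (int d * (int N * B)) + int N \<and>
        (\<forall>(A, c, s)\<in>R. sat s (q * A + c * p))"
    proof (rule rational_between)
      show "finite R" using fin by (simp add: R_def)
      show "1 \<le> int N" using N by simp
      show "0 \<le> int d * (int N * B)" by (simp add: B_def)
    next
      fix A c s assume "(A, c, s) \<in> R"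
      then obtain a where a: "(a, s) \<in> S" "A = (\<Sum>k<d. a k * y k)" "c = a d" by (auto simp: R_def)
      have "\<bar>A\<bar> \<le> (\<Sum>k<d. \<bar>a k * y k\<bar>)" unfolding a by (rule sum_abs)
      also have "\<dots> \<le> (\<Sum>k<d. int N * B)"
        using a S yb by (intro sum_mono) (force simp: abs_mult B_def intro!: mult_mono)
      finally show "\<bar>A\<bar> \<le> int d * (int N * B) \<and> \<bar>c\<bar> \<le> int N" using a S by auto
    next
      fix A s assume "(A, 0, s) \<in> R"
      thus "sat s A" using y by (auto simp: R_def S'_def)
    next
      fix A c s A' c' s' assume "(A, c, s) \<in> R" "(A', c', s') \<in> R" "0 < c" "c' < 0"
      then obtain a a' where a: "(a, s) \<in> S" "A = (\<Sum>k<d. a k * y k)" "c = a d" "0 < a d"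
         "(a', s') \<in> S" "A' = (\<Sum>k<d. a' k * y k)" "c' = a' d" "a' d < 0"
        by (auto simp: R_def)
      hence "comb ((a, s), (a', s')) \<in> S'" by (auto simp: S'_def)
      hence "sat (s \<or> s') (\<Sum>k<d. (- a' d * a k + a d * a' k) * y k)" using y by (auto simp: comb_def)
      thus "sat (s \<or> s') (- c' * A + c * A')"
        by (simp add: a algebra_simps sum.distrib sum_distrib_left sum_negf sum_subtractf)
    qed
    then obtain p q where q: "0 < q" "q \<le> 2 * (int N)\<^sup>2"
      and p: "\<bar>p\<bar> \<le> 2 * int N * (int d * (int N * B)) + int N"
      and pq: "\<forall>(A, c, s)\<in>R. sat s (q * A + c * p)" by blast
    \<comment> \<open>The solution with last entry \<open>p / q\<close>, multiplied by
      \<open>q\<close>; the system is homogeneous, so clearing the denominator is harmless.\<close>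
    define w where "w = (\<lambda>k. if k < d then q * y k else p)"
    have "\<forall>(a, s)\<in>S. sat s (\<Sum>k<Suc d. a k * w k)"
    proof safe
      fix a s assume "(a, s) \<in> S"
      hence "sat s (q * (\<Sum>k<d. a k * y k) + a d * p)" using pq by (auto simp: R_def)
      thus "sat s (\<Sum>k<Suc d. a k * w k)" by (simp add: w_def sum_distrib_left algebra_simps)
    qed
    moreover have "\<bar>w k\<bar> \<le> int (C' * N ^ (2 * e + 2))" if "k < Suc d" for k
    proof -
      have B0: "0 \<le> B" by (simp add: B_def)
      have NB: "(int N)\<^sup>2 * B = int (C * 2 ^ e * N ^ (2 * e + 2))"
        by (simp add: B_def power_add power_mult power_mult_distrib power2_eq_square)
      have N1: "int N \<le> int N ^ (2 * e + 2)" using N by (intro self_le_power) auto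
      have D: "2 * int N * (int d * (int N * B)) = 2 * int d * ((int N)\<^sup>2 * B)"
        by (simp add: power2_eq_square)
      have C': "int (C' * N ^ (2 * e + 2)) = 2 * int d * ((int N)\<^sup>2 * B) + 2 * ((int N)\<^sup>2 * B) + int N ^ (2 * e + 2)"
        unfolding NB C'_def by (simp add: algebra_simps)
      have pos: "0 \<le> (int N)\<^sup>2 * B" "0 \<le> int d * ((int N)\<^sup>2 * B)" using B0 by simp_all
      show ?thesis
      proof (cases "k < d")
        case True
        have "\<bar>w k\<bar> = q * \<bar>y k\<bar>" using True q by (simp add: w_def abs_mult)
        also have "\<dots> \<le> 2 * (int N)\<^sup>2 * B" using q yb[OF True] by (intro mult_mono) (auto simp: B_def)
        moreover have "0 \<le> 2 * int d * ((int N)\<^sup>2 * B)" using B0 by simp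
        ultimately show ?thesis using pos N1 unfolding C' by linarith
      next
        case False
        thus ?thesis using p D pos N1 unfolding C' by (simp add: w_def)
      qed
    qed
    ultimately show "\<exists>y :: nat \<Rightarrow> int. (\<forall>(a, s)\<in>S. sat s (\<Sum>k<Suc d. a k * y k)) \<and>
        (\<forall>k<Suc d. \<bar>y k\<bar> \<le> int (C' * N ^ (2 * e + 2)))" by blast
  qed
qed

text \<open>Comparing two forms means finding the sign of their difference, and differences of
  coefficients from 0 to \<open>N\<close> have absolute value at most \<open>N\<close>. All
  comparisons among the forms thus become one system for
  \<open>small_integer_solution\<close>.\<close>

lemma small_order_model:
  "\<exists>C e. \<forall>N V z. 1 \<le> N \<longrightarrow> finite V \<longrightarrow> (\<forall>u\<in>V. \<forall>k<d. 0 \<le> u k \<and> u k \<le> int N) \<longrightarrow>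
     (\<exists>y :: nat \<Rightarrow> int. (\<forall>k<d. \<bar>y k\<bar> \<le> int (C * N ^ e)) \<and>
        (\<forall>u\<in>V. \<forall>v\<in>V. (\<Sum>k<d. u k * y k) \<le> (\<Sum>k<d. v k * y k) \<longleftrightarrow>
           (\<Sum>k<d. real_of_int (u k) * z k) \<le> (\<Sum>k<d. real_of_int (v k) * z k)))"
proof -
  obtain C e where sol: "\<forall>N S z. 1 \<le> N \<longrightarrow> finite S \<longrightarrow>
     (\<forall>(a, s)\<in>S. (\<forall>k<d. \<bar>a k\<bar> \<le> int N) \<and> sat s (\<Sum>k<d. real_of_int (a k) * z k)) \<longrightarrow>
     (\<exists>y :: nat \<Rightarrow> int. (\<forall>(a, s)\<in>S. sat s (\<Sum>k<d. a k * y k)) \<and> (\<forall>k<d. \<bar>y k\<bar> \<le> int (C * N ^ e)))"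
    using small_integer_solution[of d] by (elim exE)
  show ?thesis
  proof (rule exI[of _ C], rule exI[of _ e], intro allI impI)
    fix N :: nat and V :: "(nat \<Rightarrow> int) set" and z :: "nat \<Rightarrow> real"
    assume N: "1 \<le> N" and fin: "finite V" and V: "\<forall>u\<in>V. \<forall>k<d. 0 \<le> u k \<and> u k \<le> int N"
    define lin where "lin u = (\<Sum>k<d. real_of_int (u k) * z k)" for u
    \<comment> \<open>Every difference occurs in a weak and in a strict version. Keeping those that
      hold for \<open>z\<close> records the whole order, ties included, because a tie is a weak
      inequality in both directions.\<close>
    define F where "F = (\<lambda>((u, v), s :: bool). (\<lambda>k. v k - u k :: int, s)) ` ((V \<times> V) \<times> UNIV)"
    define S where "S = {p \<in> F. sat (snd p) (lin (fst p))}"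
    have finS: "finite S" using fin by (simp add: S_def F_def)
    have SS: "\<forall>(a, s)\<in>S. (\<forall>k<d. \<bar>a k\<bar> \<le> int N) \<and> sat s (\<Sum>k<d. real_of_int (a k) * z k)"
    proof (intro ballI, clarify, intro conjI allI impI)
      fix a s assume aS: "(a, s) \<in> S"
      thus "sat s (\<Sum>k<d. real_of_int (a k) * z k)" by (simp add: S_def lin_def)
      fix k assume k: "k < d"
      obtain u v where uv: "u \<in> V" "v \<in> V" "a = (\<lambda>k. v k - u k)" using aS by (auto simp: S_def F_def)
      have "0 \<le> u k \<and> u k \<le> int N" "0 \<le> v k \<and> v k \<le> int N" using V uv k by blast+
      thus "\<bar>a k\<bar> \<le> int N" unfolding uv by linarith
    qed
    obtain y where y: "\<forall>(a, s)\<in>S. sat s (\<Sum>k<d. a k * y k)" "\<forall>k<d. \<bar>y k\<bar> \<le> int (C * N ^ e)"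
      using sol[THEN spec[of _ N], THEN spec[of _ S], THEN spec[of _ z], THEN mp, OF N, THEN mp, OF finS,
         THEN mp, OF SS] by (elim exE conjE)
    have S: "sat s (\<Sum>k<d. (v k - u k) * y k)" if "u \<in> V" "v \<in> V" "sat s (lin v - lin u)" for u v s
    proof -
      have "lin (\<lambda>k. v k - u k) = lin v - lin u"
        by (simp add: lin_def sum_subtractf left_diff_distrib)
      hence "(\<lambda>k. v k - u k, s) \<in> S" using that by (force simp: S_def F_def)
      from bspec[OF y(1) this] show ?thesis by simp
    qed
    have "(\<Sum>k<d. u k * y k) \<le> (\<Sum>k<d. v k * y k) \<longleftrightarrow> lin u \<le> lin v" if "u \<in> V" "v \<in> V" for u v
    proof -
      have diff: "(\<Sum>k<d. (a k - b k) * y k) = (\<Sum>k<d. a k * y k) - (\<Sum>k<d. b k * y k)" for a b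
        by (simp add: sum_subtractf left_diff_distrib)
      have "lin u \<le> lin v \<Longrightarrow> (\<Sum>k<d. u k * y k) \<le> (\<Sum>k<d. v k * y k)"
        using S[OF that, of False] by (simp add: sat_def diff)
      moreover have "lin v < lin u \<Longrightarrow> (\<Sum>k<d. v k * y k) < (\<Sum>k<d. u k * y k)"
        using S[OF that(2,1), of True] by (simp add: sat_def diff less_le)
      ultimately show ?thesis by linarith
    qed
    thus "\<exists>y :: nat \<Rightarrow> int. (\<forall>k<d. \<bar>y k\<bar> \<le> int (C * N ^ e)) \<and>
        (\<forall>u\<in>V. \<forall>v\<in>V. (\<Sum>k<d. u k * y k) \<le> (\<Sum>k<d. v k * y k) \<longleftrightarrow>
           (\<Sum>k<d. real_of_int (u k) * z k) \<le> (\<Sum>k<d. real_of_int (v k) * z k))"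
      using y(2) unfolding lin_def by blast
  qed
qed

section \<open>Turing machines that sweep over their input\<close>

text \<open>\<open>Sweep\<close> runs a transducer to the right over the input,
  \<open>Find c\<close> appends the letter \<open>c\<close> to the output, and \<open>Copy\<close>
  cleans up at the end. The \<open>Back\<close> phases return to cell 0 and remember what comes
  next.\<close>

datatype 'q phase = Sweep 'q | Back_sweep 'q | Back_find nat | Back_copy | Find nat | Copy

instance phase :: (countable) countable by countable_datatype

inductive table_step :: "('s \<times> sym \<Rightarrow> ('s \<times> sym \<times> move) option) \<Rightarrow> 's \<times> int \<times> (int \<Rightarrow> sym) \<Rightarrow>
    's \<times> int \<times> (int \<Rightarrow> sym) \<Rightarrow> bool" for P where
  table_stepI: "P (s, t i) = Some (s', b, d) \<Longrightarrow> table_step P (s, i, t) (s', shift d i, t(i := b))"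

text \<open>Numbering the states turns a table over any countable state type into a Turing machine.
  A run has to begin in state 0, so \<open>s0\<close> receives 0 and all other codes are shifted by
  one.\<close>

lemma tm_of_table:
  fixes P :: "('s::countable) \<times> sym \<Rightarrow> ('s \<times> sym \<times> move) option"
  assumes fin: "finite (dom P)"
    and ok: "\<And>s a s' b d. P (s, a) = Some (s', b, d) \<Longrightarrow> sym_ok r a \<and> sym_ok r b"
  shows "\<exists>D\<in>turing_machines r. \<forall>p q i t w.
           (table_step P)\<^sup>*\<^sup>* (s0, snd (initial_config p)) (q, i, t) \<longrightarrow> P (q, t i) = None \<longrightarrow>
           (\<forall>j<length w. t (int j) = Letter (w ! j)) \<longrightarrow> (\<forall>a. t (int (length w)) \<noteq> Letter a) \<longrightarrow>
           computes D p w"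
proof -
  define enc where "enc s = (if s = s0 then 0 else Suc (to_nat s))" for s
  have inj: "inj enc" by (auto simp: enc_def inj_on_def split: if_splits)
  define D :: tm where "D = (\<lambda>(q, a). if q \<in> range enc then
      map_option (\<lambda>(s', b, d). (enc s', b, d)) (P (inv enc q, a)) else None)"
  have D: "D (enc s, a) = map_option (\<lambda>(s', b, d). (enc s', b, d)) (P (s, a))" for s a
    by (simp add: D_def inj)
  have "dom D \<subseteq> (\<lambda>(s, a). (enc s, a)) ` dom P"
    by (force simp: D_def inj split: if_splits)
  hence "finite (dom D)" using fin finite_surj by blast
  moreover have "sym_ok r a \<and> sym_ok r b" if "D (q, a) = Some (q', b, d)" for q a q' b d
    using that ok by (auto simp: D_def split: if_splits)
  ultimately have "D \<in> turing_machines r" by (auto simp: turing_machines_def)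
  moreover define h where "h = (\<lambda>(s, i :: int, t :: int \<Rightarrow> sym). (enc s, i, t))"
  have sim: "(tm_step D)\<^sup>*\<^sup>* (h c) (h c')" if "(table_step P)\<^sup>*\<^sup>* c c'" for c c'
    using that
  proof induction
    case (step c' c'')
    hence "tm_step D (h c') (h c'')"
      by (auto elim!: table_step.cases simp: D h_def intro!: tm_step.intros)
    with step show ?case by simp
  qed simp
  have "computes D p w" if "(table_step P)\<^sup>*\<^sup>* (s0, snd (initial_config p)) (q, i, t)" "P (q, t i) = None"
    "\<forall>j<length w. t (int j) = Letter (w ! j)" "\<forall>a. t (int (length w)) \<noteq> Letter a" for p q i t w
    unfolding computes_def
  proof (intro exI conjI)
    show "(tm_step D)\<^sup>*\<^sup>* (initial_config p) (enc q, i, t)"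
      using sim[OF that(1)] by (simp add: initial_config_def enc_def h_def)
  qed (use that in \<open>auto simp: D\<close>)
  ultimately show ?thesis by blast
qed

section \<open>Transducers and a tape shared by input and output\<close>

fun transduce :: "('q \<Rightarrow> bool \<Rightarrow> 'q \<times> bool) \<Rightarrow> 'q \<Rightarrow> bool list \<Rightarrow> 'q \<times> bool list" where
  "transduce \<delta> q [] = (q, [])"
| "transduce \<delta> q (b # bs) = (let (q', b') = \<delta> q b; (q'', bs') = transduce \<delta> q' bs in (q'', b' # bs'))"

text \<open>Cells below the input length carry an input bit together with an optional output letter.\<close>

definition aux :: "nat \<Rightarrow> bool \<Rightarrow> nat" where
  "aux a b = 2 * a + of_bool b"

definition cell :: "bool list \<Rightarrow> nat list \<Rightarrow> int \<Rightarrow> sym" where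
  "cell w os i =
     (if i < 0 then Blank
      else if nat i < length w then
        (if nat i < length os then Aux (aux (os ! nat i) (w ! nat i)) else Bit (w ! nat i))
      else if nat i < length os then Letter (os ! nat i) else Blank)"

text \<open>The output must start in cell 0, where the input lies, and the input is reread for every
  letter. Letters are therefore first stored next to the input bits, and only \<open>Copy\<close>
  discards the bits. A sweep ends at the first cell without a bit, where \<open>out\<close> decides
  between a further letter and the end.\<close>

definition sweep_rule :: "('q \<Rightarrow> bool \<Rightarrow> 'q \<times> bool) \<Rightarrow> (nat \<Rightarrow> 'q) \<Rightarrow> ('q \<Rightarrow> nat option) \<Rightarrow>
    'q phase \<Rightarrow> sym \<Rightarrow> ('q phase \<times> sym \<times> move) option" where
  "sweep_rule \<delta> start out s a = (case s of
     Sweep q \<Rightarrow> (case a of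
        Bit b \<Rightarrow> Some (Sweep (fst (\<delta> q b)), Bit (snd (\<delta> q b)), Right)
      | Aux k \<Rightarrow> Some (Sweep (fst (\<delta> q (odd k))), Aux (aux (k div 2) (snd (\<delta> q (odd k)))), Right)
      | _ \<Rightarrow> Some (case out q of None \<Rightarrow> Back_copy | Some c \<Rightarrow> Back_find c, a, Left))
   | Back_sweep q \<Rightarrow> Some (if a = Blank then (Sweep q, a, Right) else (s, a, Left))
   | Back_find c \<Rightarrow> Some (if a = Blank then (Find c, a, Right) else (s, a, Left))
   | Back_copy \<Rightarrow> Some (if a = Blank then (Copy, a, Right) else (s, a, Left))
   | Find c \<Rightarrow> (case a of
        Bit b \<Rightarrow> Some (Back_sweep (start c), Aux (aux c b), Left)
      | Blank \<Rightarrow> Some (Back_sweep (start c), Letter c, Left)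
      | _ \<Rightarrow> Some (s, a, Right))
   | Copy \<Rightarrow> (case a of Aux k \<Rightarrow> Some (s, Letter (k div 2), Right) | _ \<Rightarrow> None))"

lemma transduce_snoc:
  "transduce \<delta> q (bs @ [b]) =
     (let (q', bs') = transduce \<delta> q bs; (q'', b') = \<delta> q' b in (q'', bs' @ [b']))"
  by (induction bs arbitrary: q) (auto simp: Let_def split: prod.splits)

lemma length_transduce [simp]: "length (snd (transduce \<delta> q bs)) = length bs"
proof (induction bs arbitrary: q)
  case (Cons b bs)
  show ?case using Cons[of "fst (\<delta> q b)"] by (simp add: case_prod_beta)
qed simp

text \<open>Reduces the construction of a machine to that of a finite transducer. Sweep
  \<open>j\<close> rewrites the input \<open>w j\<close> into \<open>w (Suc j)\<close>, and its last
  state determines the next letter or the end. Each sweep starts from the letter just written, which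
  is all that the state carries over; 0 marks the first sweep.\<close>

lemma sweep_machine:
  fixes \<delta> :: "('q::countable) \<Rightarrow> bool \<Rightarrow> 'q \<times> bool" and start :: "nat \<Rightarrow> 'q" and out :: "'q \<Rightarrow> nat option"
  assumes finQ: "finite Q"
    and startQ: "\<And>a. a \<le> r \<Longrightarrow> start a \<in> Q"
    and stepQ: "\<And>q b. q \<in> Q \<Longrightarrow> fst (\<delta> q b) \<in> Q"
    and outQ: "\<And>q a. q \<in> Q \<Longrightarrow> out q = Some a \<Longrightarrow> a \<in> {1..r}"
  shows "\<exists>D\<in>turing_machines r. \<forall>s w q.
     (\<forall>j\<le>length s. transduce \<delta> (start (if j = 0 then 0 else s ! (j - 1))) (w j) = (q j, w (Suc j))) \<longrightarrow>
     (\<forall>j<length s. out (q j) = Some (s ! j)) \<longrightarrow> out (q (length s)) = None \<longrightarrow> computes D (w 0) s"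
proof -
  \<comment> \<open>\<open>sweep_rule\<close> is defined on infinitely many states and symbols;
    cutting it down to \<open>S\<close> and \<open>A\<close> gives a finite table, and the closure
    properties of \<open>Q\<close> keep every run inside.\<close>
  define S where "S = Sweep ` Q \<union> Back_sweep ` Q \<union> Back_find ` {1..r} \<union> {Back_copy} \<union> Find ` {1..r} \<union> {Copy}"
  define A where "A = {Blank, Bit True, Bit False} \<union> Letter ` {1..r} \<union> Aux ` (\<lambda>(a, b). aux a b) ` ({1..r} \<times> UNIV)"
  define P where "P = (\<lambda>(s, a). if s \<in> S \<and> a \<in> A then sweep_rule \<delta> start out s a else None)"
  have aux_div [simp]: "aux a b div 2 = a" "odd (aux a b) = b" for a b by (auto simp: aux_def)
  have bitA [simp]: "Bit b \<in> A" for b by (cases b) (auto simp: A_def)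
  have auxA: "Aux (aux a b) \<in> A \<longleftrightarrow> a \<in> {1..r}" for a b
    unfolding A_def by (auto simp: image_iff) (metis aux_div(1))+
  have letterA: "Blank \<in> A" "a \<in> {1..r} \<Longrightarrow> Letter a \<in> A" for a by (auto simp: A_def)
  have okA: "sym_ok r a" if "a \<in> A" for a using that by (auto simp: A_def sym_ok_def)
  have "dom P \<subseteq> S \<times> A" by (auto simp: P_def split: if_splits)
  hence finP: "finite (dom P)" by (rule finite_subset) (auto simp: S_def A_def finQ)
  have P: "P (s, a) = sweep_rule \<delta> start out s a" if "s \<in> S" "a \<in> A" for s a
    using that by (simp add: P_def)
  have okP: "sym_ok r a \<and> sym_ok r b" if "P (s, a) = Some (s', b, d)" for s a s' b d
  proof -
    have s: "s \<in> S" "a \<in> A" "sweep_rule \<delta> start out s a = Some (s', b, d)"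
      using that by (auto simp: P_def split: if_splits)
    have "sym_ok r b"
      using s okA[OF s(2)] by (auto simp: sweep_rule_def S_def sym_ok_def A_def split: phase.splits sym.splits if_splits)
    thus ?thesis using okA s by simp
  qed
  obtain D where D: "D \<in> turing_machines r" and comp: "\<And>p s i t w.
           (table_step P)\<^sup>*\<^sup>* (Sweep (start 0), snd (initial_config p)) (s, i, t) \<Longrightarrow> P (s, t i) = None \<Longrightarrow>
           (\<forall>j<length w. t (int j) = Letter (w ! j)) \<Longrightarrow> (\<forall>a. t (int (length w)) \<noteq> Letter a) \<Longrightarrow>
           computes D p w"
    using tm_of_table[OF finP, of r "Sweep (start 0)"] okP by blast
  have tstep: "table_step P (s, i, t) (s', shift d i, t(i := b))"
    if "s \<in> S" "t i \<in> A" "sweep_rule \<delta> start out s (t i) = Some (s', b, d)" for s i t s' d b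
    using that by (intro table_stepI) (simp add: P)

  \<comment> \<open>Runs of the table, phase by phase\<close>
  have cellA: "cell w os i \<in> A" if "set os \<subseteq> {1..r}" for w os i
  proof -
    have "os ! nat i \<in> {1..r}" if "nat i < length os"
      using \<open>set os \<subseteq> {1..r}\<close> that nth_mem by blast
    thus ?thesis
      by (auto simp: cell_def auxA letterA simp del: atLeastAtMost_iff)
  qed
  have return: "(table_step P)\<^sup>*\<^sup>* (s, int j, t) (s', 0, t)"
    if s: "s \<in> S" "\<And>a. sweep_rule \<delta> start out s a = Some (if a = Blank then (s', a, Right) else (s, a, Left))"
      and t: "\<And>i. t i \<in> A" "t (- 1) = Blank" "\<And>i. i \<le> j \<Longrightarrow> t (int i) \<noteq> Blank" for s s' t j
  proof -
    have "(table_step P)\<^sup>*\<^sup>* (s, int j, t) (s, - 1, t)"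
      using t(3)
    proof (induction j)
      case 0
      thus ?case using tstep[of s t 0 s "t 0" Left] s t(1) by auto
    next
      case (Suc j)
      have "table_step P (s, int (Suc j), t) (s, int j, t)"
        using tstep[of s t "int (Suc j)" s "t (int (Suc j))" Left] s t(1) Suc(2)[of "Suc j"] by simp
      with Suc show ?case by (meson converse_rtranclp_into_rtranclp le_SucI)
    qed
    moreover have "table_step P (s, - 1, t) (s', 0, t)"
      using tstep[of s t "-1" s' "t (- 1)" Right] s t(1)[of "-1"] t(2) by (simp add: fun_upd_idem)
    ultimately show ?thesis by (meson rtranclp.rtrancl_into_rtrancl)
  qed
  \<comment> \<open>For \<open>j = 0\<close> the head already stands on the blank cell -1. This
    happens when the input, or the output written so far, is empty.\<close>
  have backn: "(table_step P)\<^sup>*\<^sup>* (s, int j - 1, t) (s', 0, t)"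
    if s: "s \<in> S" "\<And>a. sweep_rule \<delta> start out s a = Some (if a = Blank then (s', a, Right) else (s, a, Left))"
      and t: "\<And>i. t i \<in> A" "t (- 1) = Blank" "\<And>i. i < j \<Longrightarrow> t (int i) \<noteq> Blank" for s s' t j
  proof (cases j)
    case 0
    thus ?thesis using tstep[of s t "-1" s' "t (- 1)" Right] s t(1)[of "-1"] t(2) by (auto simp: fun_upd_idem)
  next
    case (Suc k)
    thus ?thesis using return[OF s, where j = k] t by simp
  qed

  have sweep: "(table_step P)\<^sup>*\<^sup>* (Sweep q, 0, cell w os) (Sweep (fst (transduce \<delta> q (take j w))), int j,
      cell (snd (transduce \<delta> q (take j w)) @ drop j w) os)"
     and trQ: "fst (transduce \<delta> q (take j w)) \<in> Q"
    if "q \<in> Q" "j \<le> length w" and os: "set os \<subseteq> {1..r}" for q w os j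
  proof -
    have "(table_step P)\<^sup>*\<^sup>* (Sweep q, 0, cell w os) (Sweep (fst (transduce \<delta> q (take j w))), int j,
      cell (snd (transduce \<delta> q (take j w)) @ drop j w) os) \<and> fst (transduce \<delta> q (take j w)) \<in> Q"
      using that(2)
    proof (induction j)
      case 0
      thus ?case using that by simp
    next
      case (Suc j)
      define u where "u = transduce \<delta> q (take j w)"
      have len: "length (snd u) = j" using Suc by (simp add: u_def)
      have j: "j < length w" using Suc by simp
      have u': "transduce \<delta> q (take (Suc j) w) = (fst (\<delta> (fst u) (w ! j)), snd u @ [snd (\<delta> (fst u) (w ! j))])"
        using Suc by (simp add: take_Suc_conv_app_nth transduce_snoc u_def Let_def split: prod.splits)
      define v where "v = snd u @ drop j w"
      have IH: "(table_step P)\<^sup>*\<^sup>* (Sweep q, 0, cell w os) (Sweep (fst u), int j, cell v os)" "fst u \<in> Q"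
        using Suc by (simp_all add: u_def v_def)
      have vj: "v ! j = w ! j" "j < length v" using len j by (simp_all add: v_def nth_append)
      have v': "snd (transduce \<delta> q (take (Suc j) w)) @ drop (Suc j) w = v[j := snd (\<delta> (fst u) (w ! j))]"
        using len j by (simp add: u' v_def list_update_append Cons_nth_drop_Suc[symmetric])
      define b where "b = cell (v[j := snd (\<delta> (fst u) (w ! j))]) os (int j)"
      have upd: "(cell v os)(int j := b) = cell (v[j := snd (\<delta> (fst u) (w ! j))]) os"
        by (auto simp: fun_eq_iff cell_def b_def nth_list_update)
      have "table_step P (Sweep (fst u), int j, cell v os) (Sweep (fst (\<delta> (fst u) (w ! j))), shift Right (int j),
          (cell v os)(int j := b))"
        using IH(2) vj cellA[OF os, of v "int j"]
        by (intro tstep) (auto simp: S_def sweep_rule_def b_def cell_def)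
      thus ?case using IH stepQ unfolding upd v'
        by (simp add: u' add.commute)
    qed
    thus "(table_step P)\<^sup>*\<^sup>* (Sweep q, 0, cell w os) (Sweep (fst (transduce \<delta> q (take j w))), int j,
      cell (snd (transduce \<delta> q (take j w)) @ drop j w) os)" "fst (transduce \<delta> q (take j w)) \<in> Q" by auto
  qed
  have cell_notblank: "cell w os (int i) \<noteq> Blank" if "i < length w \<or> i < length os" for w os i
    using that by (auto simp: cell_def)
  have turn: "(table_step P)\<^sup>*\<^sup>* (Sweep q, 0, cell w os) (s'', 0, cell w' os)"
    if tr: "transduce \<delta> q w = (q', w')" and q: "q \<in> Q" and os: "set os \<subseteq> {1..r}"
      and s': "s' = (case out q' of None \<Rightarrow> Back_copy | Some c \<Rightarrow> Back_find c)"
      and s'': "s'' = (case out q' of None \<Rightarrow> Copy | Some c \<Rightarrow> Find c)"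
    for q w os q' w' and s' s'' :: "'q phase"
  proof -
    have q': "q' \<in> Q" and len: "length w' = length w"
      using trQ[OF q, of "length w" w] os tr length_transduce[of \<delta> q w] by simp_all
    have sS: "s' \<in> S" using outQ[OF q'] by (auto simp: s' S_def split: option.splits)
    have "(table_step P)\<^sup>*\<^sup>* (Sweep q, 0, cell w os) (Sweep q', int (length w), cell w' os)"
      using sweep[OF q, of "length w" w os] os tr by simp
    also have "table_step P (Sweep q', int (length w), cell w' os)
       (s', shift Left (int (length w)), (cell w' os)(int (length w) := cell w' os (int (length w))))"
      using q' by (intro tstep cellA os) (auto simp: S_def sweep_rule_def s' cell_def len)
    hence "(table_step P)\<^sup>*\<^sup>* (Sweep q', int (length w), cell w' os) (s', int (length w) - 1, cell w' os)"
      by simp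
    also have "(table_step P)\<^sup>*\<^sup>* (s', int (length w) - 1, cell w' os) (s'', 0, cell w' os)"
      using len
      by (intro backn sS cell_notblank cellA os) (auto simp: s' s'' sweep_rule_def cell_def split: option.splits)
    finally show ?thesis .
  qed
  have find: "(table_step P)\<^sup>*\<^sup>* (Find c, 0, cell w os) (Sweep (start c), 0, cell w (os @ [c]))"
    if c: "c \<in> {1..r}" and os: "set os \<subseteq> {1..r}" for c w os
  proof -
    have "(table_step P)\<^sup>*\<^sup>* (Find c, 0, cell w os) (Find c, int j, cell w os)" if "j \<le> length os" for j
      using that
    proof (induction j)
      case (Suc j)
      have "table_step P (Find c, int j, cell w os) (Find c, shift Right (int j), (cell w os)(int j := cell w os (int j)))"
        using c Suc(2) by (intro tstep cellA os) (auto simp: S_def sweep_rule_def cell_def)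
      thus ?case using Suc by (simp add: add.commute)
    qed simp
    from this[of "length os"]
    have "(table_step P)\<^sup>*\<^sup>* (Find c, 0, cell w os) (Find c, int (length os), cell w os)" by simp
    also have "table_step P (Find c, int (length os), cell w os)
       (Back_sweep (start c), shift Left (int (length os)),
        (cell w os)(int (length os) := cell w (os @ [c]) (int (length os))))"
      using c by (intro tstep cellA os) (auto simp: S_def sweep_rule_def cell_def)
    moreover have "(cell w os)(int (length os) := cell w (os @ [c]) (int (length os))) = cell w (os @ [c])"
      by (auto simp: fun_eq_iff cell_def nth_append)
    ultimately have "(table_step P)\<^sup>*\<^sup>* (Find c, 0, cell w os) 
       (Back_sweep (start c), int (length os) - 1, cell w (os @ [c]))"
      by (simp add: rtranclp.rtrancl_into_rtrancl)
    also have "(table_step P)\<^sup>*\<^sup>* (Back_sweep (start c), int (length os) - 1, cell w (os @ [c])) 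
      (Sweep (start c), 0, cell w (os @ [c]))"
      using os c startQ[of c]
      by (intro backn cell_notblank cellA) (auto simp: S_def sweep_rule_def cell_def)
    finally show ?thesis .
  qed
  have copy: "\<exists>i t. (table_step P)\<^sup>*\<^sup>* (Copy, 0, cell w os) (Copy, i, t) \<and> P (Copy, t i) = None \<and>
       (\<forall>j<length os. t (int j) = Letter (os ! j)) \<and> (\<forall>a. t (int (length os)) \<noteq> Letter a)"
    if os: "set os \<subseteq> {1..r}" for w os
  proof -
    \<comment> \<open>Only below both lengths does a letter share its cell with a bit. Beyond that,
      either the letters are already plain, or the output is complete and the next cell holds a bit
      or a blank, which ends the output word.\<close>
    define n where "n = min (length w) (length os)"
    define T where "T j i = (if 0 \<le> i \<and> i < int j then Letter (os ! nat i) else cell w os i)" for j i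
    have "(table_step P)\<^sup>*\<^sup>* (Copy, 0, cell w os) (Copy, int j, T j)" if "j \<le> n" for j
      using that
    proof (induction j)
      case 0
      have "T 0 = cell w os" by (auto simp: fun_eq_iff T_def)
      thus ?case by simp
    next
      case (Suc j)
      have "table_step P (Copy, int j, T j) (Copy, shift Right (int j), (T j)(int j := Letter (os ! j)))"
        using Suc(2) cellA[OF os, of w "int j"]
        by (intro tstep) (auto simp: S_def sweep_rule_def cell_def T_def n_def)
      moreover have "(T j)(int j := Letter (os ! j)) = T (Suc j)"
        by (auto simp: fun_eq_iff T_def)
      ultimately show ?case using Suc by (simp add: add.commute)
    qed
    from this[of n] have "(table_step P)\<^sup>*\<^sup>* (Copy, 0, cell w os) (Copy, int n, T n)" by simp
    moreover have "P (Copy, T n (int n)) = None"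
      by (auto simp: P_def sweep_rule_def T_def cell_def n_def)
    moreover have "T n (int j) = Letter (os ! j)" if "j < length os" for j
      using that by (auto simp: T_def cell_def n_def)
    moreover have "T n (int (length os)) \<noteq> Letter a" for a
      by (auto simp: T_def cell_def n_def)
    ultimately show ?thesis by blast
  qed
  have "computes D (w 0) s"
    if tr: "\<And>j. j \<le> length s \<Longrightarrow> transduce \<delta> (start (if j = 0 then 0 else s ! (j - 1))) (w j) = (q j, w (Suc j))"
      and out: "\<And>j. j < length s \<Longrightarrow> out (q j) = Some (s ! j)" and halt: "out (q (length s)) = None" for s w q
  proof -
    define st where "st j = start (if j = 0 then 0 else s ! (j - 1))" for j
    \<comment> \<open>A joint induction: the next starting state lies in \<open>Q\<close> only
      because the letter just emitted lies in \<open>{1..r}\<close>, and that follows from the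
      previous sweep ending in \<open>Q\<close>.\<close>
    have "st j \<in> Q \<and> q j \<in> Q \<and> set (take j s) \<subseteq> {1..r}" if "j \<le> length s" for j
      using that
    proof (induction j)
      case 0
      have "st 0 \<in> Q" using startQ[of 0] by (simp add: st_def)
      thus ?case using trQ[of "st 0" "length (w 0)" "w 0" "[]"] tr[of 0] by (simp add: st_def)
    next
      case (Suc j)
      have s: "s ! j \<in> {1..r}" using Suc out[of j] outQ[of "q j" "s ! j"] by simp
      hence "st (Suc j) \<in> Q" using startQ by (simp add: st_def)
      moreover from this have "q (Suc j) \<in> Q"
        using trQ[of "st (Suc j)" "length (w (Suc j))" "w (Suc j)" "[]"] tr[of "Suc j"] Suc(2) by (simp add: st_def)
      ultimately show ?case using Suc s by (simp add: take_Suc_conv_app_nth)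
    qed
    hence Q: "st j \<in> Q" "q j \<in> Q" "set (take j s) \<subseteq> {1..r}" if "j \<le> length s" for j
      using that by auto
    have "(table_step P)\<^sup>*\<^sup>* (Sweep (st 0), 0, cell (w 0) []) (Sweep (st j), 0, cell (w j) (take j s))"
      if "j \<le> length s" for j
      using that
    proof (induction j)
      case (Suc j)
      have j: "j \<le> length s" "j < length s" using Suc by auto
      have c: "s ! j \<in> {1..r}" using outQ[OF Q(2)[OF j(1)]] out j by simp
      have "(table_step P)\<^sup>*\<^sup>* (Sweep (st 0), 0, cell (w 0) []) (Sweep (st j), 0, cell (w j) (take j s))"
        using Suc by simp
      also have "(table_step P)\<^sup>*\<^sup>* (Sweep (st j), 0, cell (w j) (take j s)) (Find (s ! j), 0, cell (w (Suc j)) (take j s))"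
        using turn[of "st j" "w j" "q j" "w (Suc j)" "take j s"] tr[OF j(1)] Q[OF j(1)] out[OF j(2)] by (simp add: st_def)
      also have "(table_step P)\<^sup>*\<^sup>* (Find (s ! j), 0, cell (w (Suc j)) (take j s))
          (Sweep (st (Suc j)), 0, cell (w (Suc j)) (take (Suc j) s))"
        using find[OF c Q(3)[OF j(1)]] j by (simp add: st_def take_Suc_conv_app_nth)
      finally show ?case .
    qed simp
    from this[of "length s"]
    have "(table_step P)\<^sup>*\<^sup>* (Sweep (st 0), 0, cell (w 0) []) (Sweep (st (length s)), 0, cell (w (length s)) s)" by simp
    also have "(table_step P)\<^sup>*\<^sup>* (Sweep (st (length s)), 0, cell (w (length s)) s) (Copy, 0, cell (w (Suc (length s))) s)"
      using turn[of "st (length s)" "w (length s)" "q (length s)" "w (Suc (length s))" s]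
        tr[of "length s"] Q[of "length s"] halt by (simp add: st_def)
    finally have run: "(table_step P)\<^sup>*\<^sup>* (Sweep (st 0), 0, cell (w 0) []) (Copy, 0, cell (w (Suc (length s))) s)" .
    have init: "snd (initial_config (w 0)) = (0, cell (w 0) [])"
      by (auto simp: initial_config_def cell_def fun_eq_iff)
    obtain i t where t: "(table_step P)\<^sup>*\<^sup>* (Copy, 0, cell (w (Suc (length s))) s) (Copy, i, t)" "P (Copy, t i) = None"
       "\<forall>j<length s. t (int j) = Letter (s ! j)" "\<forall>a. t (int (length s)) \<noteq> Letter a"
      using copy[of s "w (Suc (length s))"] Q(3)[of "length s"] by auto
    have "(table_step P)\<^sup>*\<^sup>* (Sweep (start 0), snd (initial_config (w 0))) (Copy, i, t)"
      using run t(1) by (simp add: init st_def)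
    from comp[OF this t(2-4)] show ?thesis .
  qed
  thus ?thesis using D by blast
qed

section \<open>Binary arithmetic in columns\<close>

fun num :: "bool list \<Rightarrow> nat" where
  "num [] = 0"
| "num (b # bs) = of_bool b + 2 * num bs"

definition bits :: "nat \<Rightarrow> nat \<Rightarrow> bool list" where
  "bits L x = map (\<lambda>l. odd (x div 2 ^ l)) [0..<L]"

lemma length_bits [simp]: "length (bits L x) = L"
  by (simp add: bits_def)

lemma bits_Suc: "bits (Suc L) x = odd x # bits L (x div 2)"
  by (simp add: bits_def upt_conv_Cons div_mult2_eq map_Suc_upt[symmetric] del: upt_Suc)

lemma num_bits: "x < 2 ^ L \<Longrightarrow> num (bits L x) = x"
proof (induction L arbitrary: x)
  case 0
  thus ?case by (simp add: bits_def)
next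
  case (Suc L)
  have "num (bits L (x div 2)) = x div 2" using Suc by auto
  thus ?case by (simp add: bits_Suc)
qed

lemma num_inj: "length xs = length ys \<Longrightarrow> num xs = num ys \<Longrightarrow> xs = ys"
proof (induction xs ys rule: list_induct2)
  case (Cons x xs y ys)
  have "x = y \<and> num xs = num ys"
    using Cons(3) by (cases x; cases y; simp; presburger)
  thus ?case using Cons by simp
qed simp

lemma num_less: "num xs < 2 ^ length xs"
  by (induction xs) (auto simp: of_bool_def)

section \<open>Addition and comparison in a single pass\<close>

type_synonym sweep_state = "nat \<times> bool \<times> bool list \<times> bool \<times> bool list"

text \<open>The input is read in columns, least significant digits first. A column holds a binary digit
  of each of the \<open>r\<close> translations, the \<open>r - 1\<close> breakpoints, the final position and the current
  position. The state \<open>(i, c, fl, e, buf)\<close> consists of the interval \<open>i\<close> whose translation is being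
  added, the carry, the results of the comparisons with the breakpoints and with the
  final position so far, and the part of the current column that has been read.\<close>

definition add_step :: "nat \<Rightarrow> sweep_state \<Rightarrow> bool \<Rightarrow> sweep_state \<times> bool" where
  "add_step r = (\<lambda>(i, c, fl, e, buf) x.
     if length buf < 2 * r then ((i, c, fl, e, buf @ [x]), x)
     else let a = (i \<noteq> 0 \<and> buf ! (i - 1)); y = ((x \<noteq> a) \<noteq> c) in
       ((i, x \<and> a \<or> x \<and> c \<or> a \<and> c, map (\<lambda>k. if buf ! (r + k) = y then fl ! k else y) [0..<r - 1],
         e \<and> buf ! (2 * r - 1) = y, []), y))"

text \<open>Flags start as \<open>True\<close> so that equality with a breakpoint counts as having
  reached it, in accordance with intervals closed on the left. The index 0 stands for adding
  nothing.\<close>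

definition add_start :: "nat \<Rightarrow> nat \<Rightarrow> sweep_state" where
  "add_start r i = (i, False, replicate (r - 1) True, True, [])"

text \<open>The breakpoints are the left ends of the intervals 2 to \<open>r\<close>, so one plus
  the number of those reached is the index of the current interval.\<close>

definition add_out :: "sweep_state \<Rightarrow> nat option" where
  "add_out = (\<lambda>(i, c, fl, e, buf). if e then None else Some (Suc (length (filter id fl))))"

text \<open>The digit of the position comes last in its column: when it is read, all other digits of
  the column are in the buffer, and it is the only cell that changes.\<close>

definition columns :: "bool list list \<Rightarrow> bool list \<Rightarrow> bool list" where
  "columns U X = concat (map2 (\<lambda>u x. u @ [x]) U X)"

lemma length_columns:
  "length U = length X \<Longrightarrow> \<forall>u\<in>set U. length u = n \<Longrightarrow> length (columns U X) = Suc n * length X"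
  by (induction U X rule: list_induct2) (auto simp: columns_def)

lemma transduce_buffer:
  "length buf + length u \<le> 2 * r \<Longrightarrow>
   transduce (add_step r) (i, c, fl, e, buf) (u @ bs) =
     map_prod id ((@) u) (transduce (add_step r) (i, c, fl, e, buf @ u) bs)"
  by (induction u arbitrary: buf) (auto simp: add_step_def map_prod_def split: prod.splits)

lemma eq_digit: "of_bool y + 2 * a = of_bool b + 2 * (c :: nat) \<longleftrightarrow> y = b \<and> a = c"
  by (cases y; cases b; simp; presburger)

text \<open>The higher digits decide a comparison. Reading from the low end, a flag must therefore
  be overwritten by each digit that differs and kept by each digit that agrees.\<close>

lemma compare_digit:
  "(if of_bool y + 2 * a = of_bool b + 2 * (c :: nat) then f else of_bool b + 2 * c < of_bool y + 2 * a) \<longleftrightarrow>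
   (if a = c then if b = y then f else y else c < a)"
  unfolding eq_digit by (cases y; cases b; auto)

text \<open>Induction from the low end, for arbitrary incoming carry and flags. The incoming flags
  survive only where the numbers read agree completely, which is why they appear in the tie case of
  the conclusion.\<close>

lemma transduce_columns:
  assumes "length U = length X" "\<forall>u\<in>set U. length u = 2 * r" "length fl = r - 1"
  shows "\<exists>c' fl' e' Y. transduce (add_step r) (i, c, fl, e, []) (columns U X) = ((i, c', fl', e', []), columns U Y) \<and>
     length Y = length X \<and> length fl' = r - 1 \<and>
     num Y + 2 ^ length X * of_bool c' =
       num X + (if i = 0 then 0 else num (map (\<lambda>u. u ! (i - 1)) U)) + of_bool c \<and>
     (\<forall>k<r - 1. fl' ! k = (if num Y = num (map (\<lambda>u. u ! (r + k)) U) then fl ! k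
        else num (map (\<lambda>u. u ! (r + k)) U) < num Y)) \<and>
     e' = (e \<and> num Y = num (map (\<lambda>u. u ! (2 * r - 1)) U))"
  using assms
proof (induction U X arbitrary: c fl e rule: list_induct2)
  case Nil
  thus ?case by (auto simp: columns_def)
next
  case (Cons u U x X)
  define a where "a = (i \<noteq> 0 \<and> u ! (i - 1))"
  define y where "y = ((x \<noteq> a) \<noteq> c)"
  define c1 where "c1 = (x \<and> a \<or> x \<and> c \<or> a \<and> c)"
  define fl1 where "fl1 = map (\<lambda>k. if u ! (r + k) = y then fl ! k else y) [0..<r - 1]"
  define e1 where "e1 = (e \<and> u ! (2 * r - 1) = y)"
  have len: "\<not> length u < 2 * r" using Cons.prems by simp
  have step: "add_step r (i, c, fl, e, u) x = ((i, c1, fl1, e1, []), y)"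
    unfolding add_step_def a_def y_def c1_def fl1_def e1_def Let_def prod.case if_not_P[OF len] by (rule refl)
  have fl1: "length fl1 = r - 1" by (simp add: fl1_def)
  have U: "\<forall>u\<in>set U. length u = 2 * r" using Cons.prems by simp
  obtain c' fl' e' Y where IH:
     "transduce (add_step r) (i, c1, fl1, e1, []) (columns U X) = ((i, c', fl', e', []), columns U Y)"
     "length Y = length X" "length fl' = r - 1"
     "num Y + 2 ^ length X * of_bool c' =
       num X + (if i = 0 then 0 else num (map (\<lambda>u. u ! (i - 1)) U)) + of_bool c1"
     "\<forall>k<r - 1. fl' ! k = (if num Y = num (map (\<lambda>u. u ! (r + k)) U) then fl1 ! k
        else num (map (\<lambda>u. u ! (r + k)) U) < num Y)"
     "e' = (e1 \<and> num Y = num (map (\<lambda>u. u ! (2 * r - 1)) U))"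
    using Cons.IH[OF U fl1, of c1 e1] by (elim exE conjE)
  show ?case
  proof (rule exI[of _ c'], rule exI[of _ fl'], rule exI[of _ e'], rule exI[of _ "y # Y"], intro conjI allI impI)
    have "columns (u # U) (x # X) = u @ (x # columns U X)" "columns (u # U) (y # Y) = u @ (y # columns U Y)"
      by (simp_all add: columns_def)
    thus "transduce (add_step r) (i, c, fl, e, []) (columns (u # U) (x # X)) =
        ((i, c', fl', e', []), columns (u # U) (y # Y))"
      using Cons.prems by (simp add: transduce_buffer step IH(1))
    have "of_bool y + 2 * of_bool c1 = of_bool x + of_bool a + (of_bool c :: nat)"
      by (auto simp: y_def c1_def)
    thus "num (y # Y) + 2 ^ length (x # X) * of_bool c' = num (x # X) +
        (if i = 0 then 0 else num (map (\<lambda>u. u ! (i - 1)) (u # U))) + of_bool c"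
      using IH(4) by (cases "i = 0") (simp_all add: a_def)
  next
    fix k assume k: "k < r - 1"
    have fl1k: "fl1 ! k = (if u ! (r + k) = y then fl ! k else y)" using k by (simp add: fl1_def)
    show "fl' ! k = (if num (y # Y) = num (map (\<lambda>u. u ! (r + k)) (u # U)) then fl ! k
        else num (map (\<lambda>u. u ! (r + k)) (u # U)) < num (y # Y))"
      unfolding IH(5)[rule_format, OF k] fl1k by (simp only: list.map num.simps compare_digit)
  next
    show "e' = (e \<and> num (y # Y) = num (map (\<lambda>u. u ! (2 * r - 1)) (u # U)))"
      unfolding IH(6) e1_def by (auto simp: eq_digit)
  qed (simp_all only: list.size IH(2,3))
qed

definition digit_table :: "nat \<Rightarrow> nat \<Rightarrow> (nat \<Rightarrow> nat) \<Rightarrow> bool list list" where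
  "digit_table r L v = map (\<lambda>l. map (\<lambda>k. odd (v k div 2 ^ l)) [0..<2 * r]) [0..<L]"

lemma digit_table_nth: "k < 2 * r \<Longrightarrow> map (\<lambda>u. u ! k) (digit_table r L v) = bits L (v k)"
  by (simp add: digit_table_def bits_def)

lemma transduce_add:
  fixes v :: "nat \<Rightarrow> nat"
  assumes r: "1 \<le> r" and i: "i \<le> r" and v: "\<And>k. k < 2 * r \<Longrightarrow> v k < 2 ^ L" and x: "x < 2 ^ L"
    and y: "y = (x + (if i = 0 then 0 else v (i - 1))) mod 2 ^ L"
  shows "\<exists>q. transduce (add_step r) (add_start r i) (columns (digit_table r L v) (bits L x)) =
       (q, columns (digit_table r L v) (bits L y)) \<and>
     add_out q = (if y = v (2 * r - 1) then None else Some (Suc (card {k. k < r - 1 \<and> v (r + k) \<le> y})))"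
proof -
  have U: "num (map (\<lambda>u. u ! k) (digit_table r L v)) = v k" if "k < 2 * r" for k
    using that v by (simp add: digit_table_nth num_bits)
  have 1: "length (digit_table r L v) = length (bits L x)" "\<forall>u\<in>set (digit_table r L v). length u = 2 * r"
     "length (replicate (r - 1) True) = r - 1" by (auto simp: digit_table_def)
  obtain c' fl' e' Y where Y: "transduce (add_step r) (i, False, replicate (r - 1) True, True, [])
       (columns (digit_table r L v) (bits L x)) = ((i, c', fl', e', []), columns (digit_table r L v) Y)"
     and lens: "length Y = length (bits L x)" "length fl' = r - 1"
     and sum: "num Y + 2 ^ length (bits L x) * of_bool c' = num (bits L x) +
       (if i = 0 then 0 else num (map (\<lambda>u. u ! (i - 1)) (digit_table r L v))) + of_bool False"
     and fl: "\<forall>k<r - 1. fl' ! k = (if num Y = num (map (\<lambda>u. u ! (r + k)) (digit_table r L v))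
       then replicate (r - 1) True ! k else num (map (\<lambda>u. u ! (r + k)) (digit_table r L v)) < num Y)"
     and e: "e' = (True \<and> num Y = num (map (\<lambda>u. u ! (2 * r - 1)) (digit_table r L v)))"
    using transduce_columns[OF 1, of i False True] by (elim exE conjE)
  have fl: "fl' ! k = (v (r + k) \<le> num Y)" if "k < r - 1" for k
  proof -
    have k: "r + k < 2 * r" using that by simp
    have "fl' ! k = (if num Y = v (r + k) then replicate (r - 1) True ! k else v (r + k) < num Y)"
      using fl[rule_format, OF that] by (simp only: U[OF k])
    thus ?thesis using that by auto
  qed
  have e: "e' = (num Y = v (2 * r - 1))" using e r by (simp add: U)
  have "num Y + 2 ^ L * of_bool c' = x + (if i = 0 then 0 else v (i - 1))"
    using sum U[of "i - 1"] i r x by (cases "i = 0") (auto simp: num_bits)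
  moreover have "num Y < 2 ^ L" using num_less[of Y] lens by simp
  \<comment> \<open>The carry out of the top column is dropped, which amounts to reduction modulo
    \<open>2 ^ L\<close>.\<close>
  ultimately have yY: "y = num Y" unfolding y by (metis mod_less mod_mult_self2)
  moreover have "y < 2 ^ L" unfolding y by simp
  ultimately have "Y = bits L y" using lens num_bits by (intro num_inj) auto
  moreover have "{k. k < length fl' \<and> id (fl' ! k)} = {k. k < r - 1 \<and> v (r + k) \<le> y}"
    using fl lens yY by auto
  ultimately show ?thesis using Y e yY unfolding add_start_def
    by (intro exI[of _ "(i, c', fl', e', [])"]) (simp add: add_out_def length_filter_conv_card)
qed

text \<open>In \<open>v\<close> the entries below \<open>r\<close> are the translations, the next
  \<open>r - 1\<close> the breakpoints, and the last one is the final position. The program consists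
  of these \<open>2 * r\<close> numbers and the starting point, with \<open>L\<close> digits
  each.\<close>

lemma translation_decoder:
  assumes r: "1 \<le> r"
  shows "\<exists>D\<in>turing_machines r. \<forall>(v :: nat \<Rightarrow> nat) L x s. (\<forall>k<2 * r. v k < 2 ^ L) \<longrightarrow> (\<forall>j\<le>length s. x j < 2 ^ L) \<longrightarrow>
     (\<forall>j<length s. x (Suc j) = (x j + v (s ! j - 1)) mod 2 ^ L) \<longrightarrow>
     (\<forall>j<length s. s ! j = Suc (card {k. k < r - 1 \<and> v (r + k) \<le> x j})) \<longrightarrow>
     (\<forall>j<length s. x j \<noteq> v (2 * r - 1)) \<longrightarrow> x (length s) = v (2 * r - 1) \<longrightarrow>
     (\<exists>p. length p = (2 * r + 1) * L \<and> computes D p s)"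
proof -
  define Q where "Q = {..r} \<times> (UNIV :: bool set) \<times> {fl :: bool list. length fl \<le> r - 1} \<times> (UNIV :: bool set) \<times>
     {buf :: bool list. length buf \<le> 2 * r}"
  have "finite Q"
    using finite_lists_length_le[of "UNIV :: bool set"] by (auto simp: Q_def intro!: finite_cartesian_product)
  moreover have "add_start r a \<in> Q" if "a \<le> r" for a using that by (auto simp: Q_def add_start_def)
  moreover have "fst (add_step r q b) \<in> Q" if "q \<in> Q" for q b
    using that by (auto simp: Q_def add_step_def Let_def)
  moreover have "a \<in> {1..r}" if "q \<in> Q" "add_out q = Some a" for q a
    using that r by (auto simp: Q_def add_out_def split: if_splits intro: order_trans[OF length_filter_le])
      (metis Suc_le_mono Suc_pred length_filter_le order_trans less_eq_Suc_le)
  ultimately obtain D where D: "D \<in> turing_machines r" and comp: "\<And>s w q.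
     (\<forall>j\<le>length s. transduce (add_step r) (add_start r (if j = 0 then 0 else s ! (j - 1))) (w j) = (q j, w (Suc j))) \<Longrightarrow>
     (\<forall>j<length s. add_out (q j) = Some (s ! j)) \<Longrightarrow> add_out (q (length s)) = None \<Longrightarrow> computes D (w 0) s"
    using sweep_machine[of Q r "add_start r" "add_step r" add_out] by blast
  have "\<exists>p. length p = (2 * r + 1) * L \<and> computes D p s"
    if v: "\<And>k. k < 2 * r \<Longrightarrow> v k < 2 ^ L" and x: "\<And>j. j \<le> length s \<Longrightarrow> x j < 2 ^ L"
      and xs: "\<And>j. j < length s \<Longrightarrow> x (Suc j) = (x j + v (s ! j - 1)) mod 2 ^ L"
      and s: "\<And>j. j < length s \<Longrightarrow> s ! j = Suc (card {k. k < r - 1 \<and> v (r + k) \<le> x j})"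
      and ne: "\<And>j. j < length s \<Longrightarrow> x j \<noteq> v (2 * r - 1)" and eq: "x (length s) = v (2 * r - 1)"
    for v x :: "nat \<Rightarrow> nat" and L s
  proof -
    \<comment> \<open>As \<open>0 - 1 = 0\<close>, both \<open>w 0\<close> and \<open>w 1\<close>
      hold the starting point: sweep 0 adds nothing and only finds the first letter. Sweep
      \<open>j\<close> leads to position \<open>x j\<close>.\<close>
    define w where "w j = columns (digit_table r L v) (bits L (x (j - 1)))" for j
    have "\<exists>q. transduce (add_step r) (add_start r (if j = 0 then 0 else s ! (j - 1))) (w j) = (q, w (Suc j)) \<and>
        add_out q = (if x j = v (2 * r - 1) then None else Some (Suc (card {k. k < r - 1 \<and> v (r + k) \<le> x j})))"
      if j: "j \<le> length s" for j
    proof (cases j)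
      case 0
      have "x 0 = (x 0 + (if 0 = (0 :: nat) then 0 else v (0 - 1))) mod 2 ^ L" using x[of 0] by simp
      from transduce_add[where v = v, OF r le0 v x[OF le0] this] show ?thesis
        unfolding 0 w_def by (simp only: simp_thms if_True diff_0_eq_0 diff_Suc_1 le0)
    next
      case (Suc m)
      have "s ! m \<le> r"
      proof -
        have "card {k. k < r - 1 \<and> v (r + k) \<le> x m} \<le> card {..<r - 1}"
          by (intro card_mono) auto
        thus ?thesis using s[of m] Suc j r by simp
      qed
      moreover have "x (Suc m) = (x m + (if s ! m = 0 then 0 else v (s ! m - 1))) mod 2 ^ L"
        using s[of m] xs[of m] Suc j by simp
      moreover have "x m < 2 ^ L" using x Suc j by simp
      ultimately show ?thesis
        using transduce_add[where v = v and i = "s ! m" and L = L and x = "x m" and y = "x (Suc m)", OF r _ v]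
        unfolding Suc w_def by (simp only: simp_thms nat.distinct if_False diff_Suc_1)
    qed
    note ex = this
    define q where "q j = fst (transduce (add_step r) (add_start r (if j = 0 then 0 else s ! (j - 1))) (w j))" for j
    have q: "transduce (add_step r) (add_start r (if j = 0 then 0 else s ! (j - 1))) (w j) = (q j, w (Suc j)) \<and>
        add_out (q j) = (if x j = v (2 * r - 1) then None else Some (Suc (card {k. k < r - 1 \<and> v (r + k) \<le> x j})))"
      if j: "j \<le> length s" for j
    proof -
      obtain q0 where q0: "transduce (add_step r) (add_start r (if j = 0 then 0 else s ! (j - 1))) (w j) = (q0, w (Suc j))"
        "add_out q0 = (if x j = v (2 * r - 1) then None else Some (Suc (card {k. k < r - 1 \<and> v (r + k) \<le> x j})))"
        using ex[OF j] by (elim exE conjE)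
      show ?thesis unfolding q_def q0(1) by (simp only: fst_conv q0(2) simp_thms)
    qed
    have "computes D (w 0) s"
    proof (intro comp[of s w q] allI impI)
      fix j assume "j \<le> length s"
      thus "transduce (add_step r) (add_start r (if j = 0 then 0 else s ! (j - 1))) (w j) = (q j, w (Suc j))"
        by (rule q[THEN conjunct1])
    next
      fix j assume "j < length s"
      thus "add_out (q j) = Some (s ! j)" using q[of j, THEN conjunct2] s[of j] ne[of j] by (simp only: less_imp_le if_False)
    next
      show "add_out (q (length s)) = None" using q[of "length s", THEN conjunct2] eq by simp
    qed
    moreover have "length (w 0) = (2 * r + 1) * L"
      using length_columns[of "digit_table r L v" "bits L (x 0)" "2 * r"]
      by (simp add: w_def digit_table_def)
    ultimately show ?thesis by blast
  qed
  thus ?thesis using D by blast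
qed

text \<open>Intervals have disappeared from the hypotheses: what remains is how the positions
  compare with 0, with the breakpoints and with the last position. All of this survives the passage
  from \<open>X\<close>, \<open>\<alpha>\<close>, \<open>\<beta>\<close> to a small integer
  model.\<close>

lemma translation_word_program:
  assumes r: "1 \<le> r"
  shows "\<exists>D\<in>turing_machines r. \<exists>A K :: nat. \<forall>s (X :: nat \<Rightarrow> real) \<alpha> \<beta>.
     (\<forall>j<length s. s ! j \<in> {1..r} \<and> X (Suc j) = X j + \<alpha> (s ! j)) \<longrightarrow>
     (\<forall>j\<le>length s. 0 \<le> X j) \<longrightarrow> (\<forall>k<r - 1. 0 \<le> \<beta> k) \<longrightarrow>
     (\<forall>j<length s. \<forall>k<r - 1. \<beta> k \<le> X j \<longleftrightarrow> k + 1 < s ! j) \<longrightarrow>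
     (\<forall>j<length s. X j \<noteq> X (length s)) \<longrightarrow>
     (\<exists>p. length p \<le> A + K * nat \<lceil>log 2 (real (length s) + 1)\<rceil> \<and> computes D p s)"
proof -
  obtain D where D: "D \<in> turing_machines r" and dec: "\<forall>(v :: nat \<Rightarrow> nat) L x s. (\<forall>k<2 * r. v k < 2 ^ L) \<longrightarrow> (\<forall>j\<le>length s. x j < 2 ^ L) \<longrightarrow>
     (\<forall>j<length s. x (Suc j) = (x j + v (s ! j - 1)) mod 2 ^ L) \<longrightarrow>
     (\<forall>j<length s. s ! j = Suc (card {k. k < r - 1 \<and> v (r + k) \<le> x j})) \<longrightarrow>
     (\<forall>j<length s. x j \<noteq> v (2 * r - 1)) \<longrightarrow> x (length s) = v (2 * r - 1) \<longrightarrow>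
     (\<exists>p. length p = (2 * r + 1) * L \<and> computes D p s)"
    using translation_decoder[OF r] by (elim bexE)
  obtain C e where mod: "\<forall>N V z. 1 \<le> N \<longrightarrow> finite V \<longrightarrow> (\<forall>u\<in>V. \<forall>k<2 * r. 0 \<le> u k \<and> u k \<le> int N) \<longrightarrow>
     (\<exists>y :: nat \<Rightarrow> int. (\<forall>k<2 * r. \<bar>y k\<bar> \<le> int (C * N ^ e)) \<and>
        (\<forall>u\<in>V. \<forall>v\<in>V. (\<Sum>k<2 * r. u k * y k) \<le> (\<Sum>k<2 * r. v k * y k) \<longleftrightarrow>
           (\<Sum>k<2 * r. real_of_int (u k) * z k) \<le> (\<Sum>k<2 * r. real_of_int (v k) * z k)))"
    using small_order_model[of "2 * r"] by (elim exE)
  have main: "\<exists>p. length p \<le> (2 * r + 1) * C + ((2 * r + 1) * (e + 1)) * nat \<lceil>log 2 (real (length s) + 1)\<rceil> \<and> computes D p s"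
    if s: "\<And>j. j < length s \<Longrightarrow> s ! j \<in> {1..r}" and X: "\<And>j. j < length s \<Longrightarrow> X (Suc j) = X j + \<alpha> (s ! j)"
      and X0: "\<And>j. j \<le> length s \<Longrightarrow> 0 \<le> X j" and \<beta>0: "\<And>k. k < r - 1 \<Longrightarrow> 0 \<le> \<beta> k"
      and \<beta>: "\<And>j k. j < length s \<Longrightarrow> k < r - 1 \<Longrightarrow> \<beta> k \<le> X j \<longleftrightarrow> k + 1 < s ! j"
      and ne: "\<And>j. j < length s \<Longrightarrow> X j \<noteq> X (length s)"
    for s and X \<alpha> \<beta> :: "nat \<Rightarrow> real"
  proof -
    define n where "n = length s"
    define L0 where "L0 = nat \<lceil>log 2 (real n + 1)\<rceil>"
    \<comment> \<open>Positions in the model are at most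
      \<open>(n + 1) * B = C * (n + 1) ^ (e + 1)\<close>; this fits into \<open>L\<close> digits
      because \<open>n + 1 \<le> 2 ^ L0\<close> and \<open>C < 2 ^ C\<close>.\<close>
    define L where "L = C + (e + 1) * L0"
    define B where "B = C * (n + 1) ^ e"
    \<comment> \<open>The unknowns are \<open>X 0\<close> at index 0, the translations at \<open>1..r\<close> and the breakpoints after them.\<close>
    define z where "z k = (if k = 0 then X 0 else if k \<le> r then \<alpha> k else \<beta> (k - (r + 1)))" for k
    \<comment> \<open>The coefficients of \<open>X j\<close> as a form in the unknowns: the starting
      point once, and each translation as often as its letter occurs among the first
      \<open>j\<close>.\<close>
    define pos where "pos j k = (if k = 0 then 1 else 0) + (\<Sum>l<j. if s ! l = k then 1 else (0 :: int))" for j k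
    define unit where "unit i k = (if k = r + 1 + i then 1 else (0 :: int))" for i k
    \<comment> \<open>The zero form is included so that the model inherits nonnegativity, without
      which positions and breakpoints could not be written in binary.\<close>
    define V where "V = insert (\<lambda>_. 0) (pos ` {..n} \<union> unit ` {..<r - 1})"
    have pos: "(\<Sum>k<2 * r. of_int (pos j k) * y k) = y 0 + (\<Sum>l<j. y (s ! l))"
      if "j \<le> n" for j and y :: "nat \<Rightarrow> 'a :: comm_ring_1"
      using that
    proof (induction j)
      case 0
      have "(\<Sum>k<2 * r. of_int (pos 0 k) * y k) = (\<Sum>k<2 * r. if k = 0 then y k else 0)"
        by (intro sum.cong) (auto simp: pos_def)
      thus ?case using r by simp
    next
      case (Suc j)
      have j: "s ! j < 2 * r" using s[of j] Suc r by (simp add: n_def)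
      have "(\<Sum>k<2 * r. of_int (pos (Suc j) k) * y k) =
          (\<Sum>k<2 * r. of_int (pos j k) * y k) + (\<Sum>k<2 * r. if k = s ! j then y k else 0)"
        unfolding sum.distrib[symmetric] by (intro sum.cong) (auto simp: pos_def algebra_simps)
      thus ?case using Suc j by (simp add: algebra_simps)
    qed
    have unit: "(\<Sum>k<2 * r. of_int (unit i k) * y k) = y (r + 1 + i)"
      if "i < r - 1" for i and y :: "nat \<Rightarrow> 'a :: comm_ring_1"
    proof -
      have "(\<Sum>k<2 * r. of_int (unit i k) * y k) = (\<Sum>k<2 * r. if k = r + 1 + i then y k else 0)"
        by (intro sum.cong) (auto simp: unit_def)
      thus ?thesis using that by simp
    qed
    have Vb: "\<forall>u\<in>V. \<forall>k<2 * r. 0 \<le> u k \<and> u k \<le> int (n + 1)"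
    proof -
      have "0 \<le> pos j k \<and> pos j k \<le> int (n + 1)" if "j \<le> n" for j k
      proof -
        have "(\<Sum>l<j. if s ! l = k then 1 else (0 :: int)) \<le> (\<Sum>l<j. 1)" by (intro sum_mono) auto
        moreover have "0 \<le> (\<Sum>l<j. if s ! l = k then 1 else (0 :: int))" by (intro sum_nonneg) auto
        ultimately show ?thesis using that by (auto simp: pos_def)
      qed
      thus ?thesis by (auto simp: V_def unit_def)
    qed
    have finV: "finite V" by (simp add: V_def)
    have n1: "1 \<le> n + 1" by simp
    obtain y where yB: "\<forall>k<2 * r. \<bar>y k\<bar> \<le> int B"
      and y: "\<forall>u\<in>V. \<forall>v\<in>V. (\<Sum>k<2 * r. u k * y k) \<le> (\<Sum>k<2 * r. v k * y k) \<longleftrightarrow>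
           (\<Sum>k<2 * r. real_of_int (u k) * z k) \<le> (\<Sum>k<2 * r. real_of_int (v k) * z k)"
      using mod[THEN spec[of _ "n + 1"], THEN spec[of _ V], THEN spec[of _ z], THEN mp, OF n1, THEN mp, OF finV,
         THEN mp, OF Vb] unfolding B_def by (elim exE conjE)
    define X' where "X' j = y 0 + (\<Sum>l<j. y (s ! l))" for j
    define \<beta>' where "\<beta>' k = y (r + 1 + k)" for k
    have posz: "(\<Sum>k<2 * r. real_of_int (pos j k) * z k) = X j" if "j \<le> n" for j
    proof -
      have "z 0 + (\<Sum>l<j. z (s ! l)) = X j"
        using that
      proof (induction j)
        case (Suc j)
        have "z (s ! j) = \<alpha> (s ! j)" using s[of j] Suc by (simp add: z_def n_def)
        thus ?case using X[of j] Suc by (simp add: n_def algebra_simps)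
      qed (simp add: z_def)
      thus ?thesis using pos[OF that, of z] by simp
    qed
    have posy: "(\<Sum>k<2 * r. pos j k * y k) = X' j" if "j \<le> n" for j
      using pos[OF that, of y] by (simp add: X'_def)
    have unitz: "(\<Sum>k<2 * r. real_of_int (unit i k) * z k) = \<beta> i" if "i < r - 1" for i
      using unit[OF that, of z] by (simp add: z_def)
    have unity: "(\<Sum>k<2 * r. unit i k * y k) = \<beta>' i" if "i < r - 1" for i
      using unit[OF that, of y] by (simp add: \<beta>'_def)
    have VI: "(\<lambda>_. 0) \<in> V" "j \<le> n \<Longrightarrow> pos j \<in> V" "i < r - 1 \<Longrightarrow> unit i \<in> V" for i j
      by (auto simp: V_def)
    have X'0: "0 \<le> X' j" if "j \<le> n" for j
      using y[rule_format, OF VI(1) VI(2)[OF that]] X0[of j] that by (simp add: posz posy n_def)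
    have \<beta>'0: "0 \<le> \<beta>' i" if "i < r - 1" for i
      using y[rule_format, OF VI(1) VI(3)[OF that]] \<beta>0[of i] that by (simp add: unitz unity)
    have \<beta>': "\<beta>' i \<le> X' j \<longleftrightarrow> i + 1 < s ! j" if "j < n" "i < r - 1" for i j
      using y[rule_format, OF VI(3)[OF that(2)] VI(2), of j] \<beta>[of j i] that
      by (simp add: unitz unity posz posy n_def)
    have ne': "X' j \<noteq> X' n" if "j < n" for j
    proof
      assume eq: "X' j = X' n"
      have "X j \<le> X n" "X n \<le> X j"
        using y[rule_format, OF VI(2) VI(2), of j n] y[rule_format, OF VI(2) VI(2), of n j] that
        by (simp_all add: posz posy eq)
      thus False using ne[of j] that by (simp add: n_def)
    qed
    have X'B: "X' j \<le> int ((n + 1) * B)" if "j \<le> n" for j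
    proof -
      have "X' j \<le> int B + (\<Sum>l<j. int B)"
        unfolding X'_def
      proof (intro add_mono sum_mono)
        show "y 0 \<le> int B" using yB[rule_format, of 0] r by auto
        fix l assume "l \<in> {..<j}"
        hence "s ! l < 2 * r" using s[of l] that r by (simp add: n_def)
        thus "y (s ! l) \<le> int B" using yB by fastforce
      qed
      also have "\<dots> = int ((j + 1) * B)" by (simp add: algebra_simps)
      also have "\<dots> \<le> int ((n + 1) * B)" using that by (intro of_nat_mono mult_right_mono) auto
      finally show ?thesis .
    qed
    have BL: "(n + 1) * B < 2 ^ L"
    proof -
      have "log 2 (real n + 1) \<le> real L0" unfolding L0_def by linarith
      hence "real n + 1 \<le> 2 powr real L0" by (subst (asm) log_le_iff) auto
      hence "real (n + 1) \<le> real (2 ^ L0)" by (simp add: powr_realpow)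
      hence "n + 1 \<le> 2 ^ L0" by (simp only: of_nat_le_iff)
      hence "(n + 1) ^ (e + 1) \<le> (2 ^ L0) ^ (e + 1)" by (rule power_mono) simp
      hence "(n + 1) ^ (e + 1) \<le> 2 ^ ((e + 1) * L0)" by (simp only: power_mult[symmetric] mult.commute)
      hence "C * (n + 1) ^ (e + 1) \<le> C * 2 ^ ((e + 1) * L0)" by (rule mult_left_mono) simp
      also have "\<dots> < 2 ^ C * 2 ^ ((e + 1) * L0)" by (intro mult_strict_right_mono) auto
      finally show ?thesis by (simp add: B_def L_def power_add algebra_simps)
    qed
    have X'L: "X' j < 2 ^ L" if "j \<le> n" for j
    proof -
      have "int ((n + 1) * B) < int (2 ^ L)" using BL by (simp only: of_nat_less_iff)
      thus ?thesis using X'B[OF that] by simp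
    qed
    have \<beta>'L: "\<beta>' i < 2 ^ L" if "i < r - 1" for i
    proof -
      have "r + 1 + i < 2 * r" using that by simp
      hence "\<beta>' i \<le> int B" unfolding \<beta>'_def using yB abs_le_D1 by blast
      also have "\<dots> \<le> int ((n + 1) * B)" by simp
      also have "\<dots> < int (2 ^ L)" using BL by (simp only: of_nat_less_iff)
      finally show ?thesis by simp
    qed
    \<comment> \<open>Translations may be negative, so they are added modulo \<open>2 ^ L\<close>.\<close>
    define v where "v k = (if k < r then nat (y (k + 1) mod 2 ^ L) else if k < 2 * r - 1 then nat (\<beta>' (k - r))
       else nat (X' n))" for k
    define x where "x j = nat (X' j)" for j
    have nat_less: "nat a < 2 ^ L" if "a < 2 ^ L" for a :: int
      using that by (simp add: nat_less_iff)
    have "\<exists>p. length p = (2 * r + 1) * L \<and> computes D p s"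
    proof (rule dec[rule_format, of v L s x])
      fix k assume "k < 2 * r"
      thus "v k < 2 ^ L" using \<beta>'L[of "k - r"] X'L[of n] by (auto simp: v_def intro!: nat_less)
    next
      fix j assume "j \<le> length s"
      thus "x j < 2 ^ L" using X'L[of j] by (simp add: x_def n_def nat_less)
    next
      fix j assume j: "j < length s"
      have "s ! j - 1 < r" "s ! j - 1 + 1 = s ! j" using s[OF j] by auto
      hence vs: "v (s ! j - 1) = nat (y (s ! j) mod 2 ^ L)" by (simp add: v_def)
      have "int (x (Suc j)) = X' (Suc j) mod 2 ^ L"
        using X'0[of "Suc j"] X'L[of "Suc j"] j by (simp add: x_def n_def)
      also have "X' (Suc j) = X' j + y (s ! j)" by (simp add: X'_def)
      also have "\<dots> mod 2 ^ L = (X' j + y (s ! j) mod 2 ^ L) mod 2 ^ L" by (simp add: mod_simps)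
      also have "X' j = int (x j)" using X'0[of j] j by (simp add: x_def n_def)
      also have "y (s ! j) mod 2 ^ L = int (v (s ! j - 1))" unfolding vs by simp
      also have "(int (x j) + int (v (s ! j - 1))) mod 2 ^ L = int ((x j + v (s ! j - 1)) mod 2 ^ L)"
        by (simp add: zmod_int)
      finally show "x (Suc j) = (x j + v (s ! j - 1)) mod 2 ^ L" by (simp only: of_nat_eq_iff)
    next
      fix j assume j: "j < length s"
      have vk: "v (r + k) = nat (\<beta>' k)" if "k < r - 1" for k
      proof -
        have "\<not> r + k < r" "r + k < 2 * r - 1" using that by linarith+
        thus ?thesis by (simp only: v_def if_True if_False diff_add_inverse)
      qed
      \<comment> \<open>The breakpoints reached form an initial segment, so counting them recovers
        the letter.\<close>
      have "{k. k < r - 1 \<and> v (r + k) \<le> x j} = {..<s ! j - 1}"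
      proof (intro set_eqI iffI)
        fix k assume "k \<in> {k. k < r - 1 \<and> v (r + k) \<le> x j}"
        thus "k \<in> {..<s ! j - 1}" using \<beta>'[of j k] j X'0[of j] by (auto simp: vk x_def n_def)
      next
        fix k assume k: "k \<in> {..<s ! j - 1}"
        hence "k < r - 1" using s[OF j] by auto
        thus "k \<in> {k. k < r - 1 \<and> v (r + k) \<le> x j}"
          using \<beta>'[of j k] j k by (auto simp: vk x_def n_def nat_mono)
      qed
      thus "s ! j = Suc (card {k. k < r - 1 \<and> v (r + k) \<le> x j})" using s[OF j] by simp
    next
      have v: "v (2 * r - 1) = x n" using r by (simp add: v_def x_def)
      show "x (length s) = v (2 * r - 1)" unfolding v by (simp only: n_def)
      fix j assume j: "j < length s"
      show "x j \<noteq> v (2 * r - 1)"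
        unfolding v using ne'[of j] X'0[of j] X'0[of n] j by (simp add: x_def n_def)
    qed
    moreover have "(2 * r + 1) * L = (2 * r + 1) * C + ((2 * r + 1) * (e + 1)) * L0"
      by (simp add: L_def algebra_simps)
    ultimately show ?thesis unfolding L0_def n_def by (metis order_refl)
  qed
  show ?thesis
  proof (rule bexI[OF _ D], rule exI[of _ "(2 * r + 1) * C"], rule exI[of _ "(2 * r + 1) * (e + 1)"],
      intro allI impI)
    fix s and X \<alpha> \<beta> :: "nat \<Rightarrow> real"
    assume "\<forall>j<length s. s ! j \<in> {1..r} \<and> X (Suc j) = X j + \<alpha> (s ! j)" "\<forall>j\<le>length s. 0 \<le> X j"
      "\<forall>k<r - 1. 0 \<le> \<beta> k" "\<forall>j<length s. \<forall>k<r - 1. \<beta> k \<le> X j \<longleftrightarrow> k + 1 < s ! j"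
      "\<forall>j<length s. X j \<noteq> X (length s)"
    thus "\<exists>p. length p \<le> (2 * r + 1) * C + ((2 * r + 1) * (e + 1)) * nat \<lceil>log 2 (real (length s) + 1)\<rceil> \<and>
        computes D p s"
      by (intro main[of s X \<alpha> \<beta>]; blast)
  qed
qed

section \<open>Interval exchange transformations\<close>

lemma interval_partition_endpoints:
  assumes "interval_partition r I"
  obtains a b where "\<And>i. i \<in> {1..r} \<Longrightarrow> a i < b i \<and> I i = {a i..<b i}"
  using assms unfolding interval_partition_def by metis

lemma interval_partition_unique:
  assumes "interval_partition r I" "x \<in> {0..<1}"
  shows "\<exists>!i. i \<in> {1..r} \<and> x \<in> I i"
  using assms unfolding interval_partition_def disjoint_family_on_def by blast

text \<open>The translation carries the left end of \<open>I i\<close> to the total length of the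
  intervals placed before its image. Adding the length of \<open>I i\<close> itself gives at most
  the sum of all lengths, which is 1. This keeps orbits inside the domain of the coding.\<close>

lemma interval_exchange_maps_unit:
  assumes T: "interval_exchange r I \<sigma> T" and x: "x \<in> {0..<1}"
  shows "T x \<in> {0..<1}"
proof -
  have part: "interval_partition r I" and \<sigma>: "\<sigma> permutes {1..r}"
    and Tx: "\<And>i x. i \<in> {1..r} \<Longrightarrow> x \<in> I i \<Longrightarrow> T x = x + translation I \<sigma> i"
    using T by (auto simp: interval_exchange_def)
  obtain a b where ab: "\<And>i. i \<in> {1..r} \<Longrightarrow> a i < b i \<and> I i = {a i..<b i}"
    using interval_partition_endpoints[OF part] by blast
  define len where "len i = measure lborel (I i)" for i
  have disj: "disjoint_family_on I {1..r}" and un: "(\<Union>i\<in>{1..r}. I i) = {0..<1}"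
    and ord: "\<And>i j x y. i \<in> {1..r} \<Longrightarrow> j \<in> {1..r} \<Longrightarrow> i < j \<Longrightarrow> x \<in> I i \<Longrightarrow> y \<in> I j \<Longrightarrow> x < y"
    using part unfolding interval_partition_def by blast+
  have aI: "a i \<in> I i" "len i = b i - a i" if "i \<in> {1..r}" for i
    using ab[OF that] by (auto simp: len_def)
  have sum_len: "(\<Sum>i\<in>J. len i) = measure lborel (\<Union>i\<in>J. I i)" if "J \<subseteq> {1..r}" for J
    unfolding len_def
  proof (rule measure_finite_Union[symmetric])
    show "finite J" using that finite_subset by blast
    show "I ` J \<subseteq> sets lborel" using ab that by fastforce
    show "disjoint_family_on I J" using disj that by (rule disjoint_family_on_mono[rotated])
    fix i assume "i \<in> J"
    hence "a i < b i \<and> I i = {a i..<b i}" using ab that by blast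
    thus "emeasure lborel (I i) \<noteq> \<infinity>" by simp
  qed
  obtain i where i: "i \<in> {1..r}" "x \<in> I i" using interval_partition_unique[OF part x] by blast
  \<comment> \<open>The intervals to the left of \<open>I i\<close> fill everything up to its left
    end, so the second sum in \<open>translation\<close> is \<open>a i\<close>.\<close>
  have "(\<Union>k\<in>{1..<i}. I k) = {0..<a i}"
  proof (intro set_eqI iffI)
    fix y assume "y \<in> (\<Union>k\<in>{1..<i}. I k)"
    then obtain k where k: "k \<in> {1..r}" "k < i" "y \<in> I k" using i by auto
    hence "y \<in> {0..<1}" using un by blast
    thus "y \<in> {0..<a i}" using ord[OF k(1) i(1) k(2,3) aI(1)[OF i(1)]] by simp
  next
    fix y assume y: "y \<in> {0..<a i}"
    moreover have "a i \<in> {0..<1}" using aI(1)[OF i(1)] un i(1) by blast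
    ultimately have "y \<in> {0..<1}" by auto
    then obtain k where k: "k \<in> {1..r}" "y \<in> I k" using un by blast
    have "\<not> i \<le> k"
    proof
      assume "i \<le> k"
      hence "a i \<le> y" using ord[OF i(1) k(1) _ aI(1)[OF i(1)] k(2)] ab[OF i(1)] k(2) by (cases "i = k") auto
      thus False using y by simp
    qed
    thus "y \<in> (\<Union>k\<in>{1..<i}. I k)" using k by auto
  qed
  moreover have "a i \<in> {0..<1}" using aI(1)[OF i(1)] un i(1) by blast
  moreover have sub: "{1..<i} \<subseteq> {1..r}" using i by auto
  ultimately have ai: "(\<Sum>k\<in>{1..<i}. len k) = a i"
    using sum_len[OF sub] by simp
  define p where "p = inv \<sigma> i"
  have p: "p \<in> {1..r}" "\<sigma> p = i"
    using permutes_in_image[OF permutes_inv[OF \<sigma>], of i] permutes_inverses(1)[OF \<sigma>, of i] i(1)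
    by (simp_all only: p_def)
  have len0: "0 \<le> len k" for k by (simp add: len_def)
  have "(\<Sum>k\<in>{1..<p}. len (\<sigma> k)) + len i = (\<Sum>k\<in>{1..p}. len (\<sigma> k))"
    using p by (simp add: atLeastLessThanSuc_atLeastAtMost[symmetric])
  also have "\<dots> \<le> (\<Sum>k\<in>{1..r}. len (\<sigma> k))" using p len0 by (intro sum_mono2) auto
  also have "\<dots> = (\<Sum>k\<in>{1..r}. len k)" using sum.permute[OF \<sigma>, of len] by simp
  also have "\<dots> = 1" using sum_len[of "{1..r}"] un by simp
  finally have le: "(\<Sum>k\<in>{1..<p}. len (\<sigma> k)) + len i \<le> 1" .
  have "T x = x + (\<Sum>k\<in>{1..<p}. len (\<sigma> k)) - a i"
    using Tx[OF i] ai by (simp add: translation_def len_def p_def)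
  moreover have "0 \<le> (\<Sum>k\<in>{1..<p}. len (\<sigma> k))" using len0 by (intro sum_nonneg) auto
  moreover have "a i \<le> x" "x < b i" using i ab by auto
  ultimately show ?thesis using le aI(2)[OF i(1)] by simp
qed

text \<open>The orbit of \<open>x\<close> and the left ends of the intervals satisfy the hypotheses
  of \<open>translation_word_program\<close>. Machine and constants come from there, so they are the
  same for all \<open>x\<close> and \<open>n\<close>.\<close>

lemma coding_word_program:
  assumes r: "1 \<le> r" and T: "interval_exchange r I \<sigma> T" and ap: "aperiodic T"
  shows "\<exists>D\<in>turing_machines r. \<exists>A K. \<forall>x\<in>{0..<1}. \<forall>n.
     \<exists>p. length p \<le> A + K * nat \<lceil>log 2 (real n + 1)\<rceil> \<and> computes D p (coding_word r I T x n)"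
proof -
  have part: "interval_partition r I"
    and Tx: "\<And>i x. i \<in> {1..r} \<Longrightarrow> x \<in> I i \<Longrightarrow> T x = x + translation I \<sigma> i"
    using T by (auto simp: interval_exchange_def)
  obtain a b where ab: "\<And>i. i \<in> {1..r} \<Longrightarrow> a i < b i \<and> I i = {a i..<b i}"
    using interval_partition_endpoints[OF part] by blast
  have un: "(\<Union>i\<in>{1..r}. I i) = {0..<1}"
    and ord: "\<And>i j x y. i \<in> {1..r} \<Longrightarrow> j \<in> {1..r} \<Longrightarrow> i < j \<Longrightarrow> x \<in> I i \<Longrightarrow> y \<in> I j \<Longrightarrow> x < y"
    using part unfolding interval_partition_def by blast+
  obtain D A K where D: "D \<in> turing_machines r" and prog: "\<And>s (X :: nat \<Rightarrow> real) \<alpha> \<beta>.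
     (\<forall>j<length s. s ! j \<in> {1..r} \<and> X (Suc j) = X j + \<alpha> (s ! j)) \<Longrightarrow>
     (\<forall>j\<le>length s. 0 \<le> X j) \<Longrightarrow> (\<forall>k<r - 1. 0 \<le> \<beta> k) \<Longrightarrow>
     (\<forall>j<length s. \<forall>k<r - 1. \<beta> k \<le> X j \<longleftrightarrow> k + 1 < s ! j) \<Longrightarrow>
     (\<forall>j<length s. X j \<noteq> X (length s)) \<Longrightarrow>
     (\<exists>p. length p \<le> A + K * nat \<lceil>log 2 (real (length s) + 1)\<rceil> \<and> computes D p s)"
    using translation_word_program[OF r] by blast
  have "\<exists>p. length p \<le> A + K * nat \<lceil>log 2 (real n + 1)\<rceil> \<and> computes D p (coding_word r I T x n)"
    if x: "x \<in> {0..<1}" for x n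
  proof -
    define X where "X j = (T ^^ j) x" for j
    define s where "s = coding_word r I T x n"
    have len: "length s = n" by (simp add: s_def coding_word_def)
    have X: "X j \<in> {0..<1}" for j
      by (induction j) (use x interval_exchange_maps_unit[OF T] in \<open>auto simp: X_def\<close>)
    have s: "s ! j \<in> {1..r} \<and> X j \<in> I (s ! j)" if "j < n" for j
    proof -
      have "s ! j = (THE i. i \<in> {1..r} \<and> X j \<in> I i)"
        using that by (simp add: s_def coding_word_def coding_def X_def)
      thus ?thesis using theI'[OF interval_partition_unique[OF part X[of j]]] by simp
    qed
    \<comment> \<open>The shift by 2 arises because breakpoints are counted from 0, intervals from
      1, and the left end of the first interval is not a breakpoint.\<close>
    have le: "a (k + 2) \<le> X j \<longleftrightarrow> k + 1 < s ! j" if j: "j < n" and k: "k < r - 1" for j k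
    proof -
      have k2: "k + 2 \<in> {1..r}" "a (k + 2) \<in> I (k + 2)" using k ab[of "k + 2"] by auto
      note sj = s[OF j, THEN conjunct1] s[OF j, THEN conjunct2]
      consider "s ! j < k + 2" | "s ! j = k + 2" | "k + 2 < s ! j" by linarith
      thus ?thesis
      proof cases
        case 1
        thus ?thesis using ord[OF sj(1) k2(1) 1 sj(2) k2(2)] by simp
      next
        case 2
        thus ?thesis using sj ab[OF k2(1)] by simp
      next
        case 3
        thus ?thesis using ord[OF k2(1) sj(1) 3 k2(2) sj(2)] by simp
      qed
    qed
    have "\<exists>p. length p \<le> A + K * nat \<lceil>log 2 (real (length s) + 1)\<rceil> \<and> computes D p s"
    proof (rule prog[of s X "translation I \<sigma>" "\<lambda>k. a (k + 2)"]; intro allI impI)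
      fix j assume j: "j < length s"
      show "s ! j \<in> {1..r} \<and> X (Suc j) = X j + translation I \<sigma> (s ! j)"
        using s[of j] Tx[of "s ! j" "X j"] j len by (simp add: X_def)
      show "X j \<noteq> X (length s)"
      proof
        assume eq: "X j = X (length s)"
        \<comment> \<open>A repetition would make \<open>X j\<close>, a point of the unit interval,
          periodic.\<close>
        have "X (length s) = (T ^^ (length s - j)) (X j)"
          using j funpow_add[of "length s - j" j T] by (simp add: X_def)
        moreover have "1 \<le> length s - j" using j by simp
        ultimately show False using ap X[of j] eq unfolding aperiodic_def by metis
      qed
      fix k assume "k < r - 1"
      thus "a (k + 2) \<le> X j \<longleftrightarrow> k + 1 < s ! j" using le j len by simp
    next
      fix j show "0 \<le> X j" using X[of j] by simp
    next
      fix k assume "k < r - 1"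
      hence "a (k + 2) \<in> I (k + 2)" "k + 2 \<in> {1..r}" using ab[of "k + 2"] by auto
      hence "a (k + 2) \<in> {0..<1}" using un by blast
      thus "0 \<le> a (k + 2)" by simp
    qed
    thus ?thesis by (simp only: len) (simp only: s_def)
  qed
  thus ?thesis using D by blast
qed

section \<open>Algorithmic information content\<close>

lemma AIC_le: "computes U p s \<Longrightarrow> AIC U s \<le> enat (length p)"
  unfolding AIC_def by (rule Inf_lower) auto

lemma AIC_eq_0: "AIC U s = 0 \<Longrightarrow> computes U [] s"
proof -
  assume "AIC U s = 0"
  hence "Inf {enat (length p) |p. computes U p s} < 1" by (simp add: AIC_def)
  then obtain p where "computes U p s" "enat (length p) < 1" unfolding Inf_less_iff by blast
  thus ?thesis by (simp add: one_enat_def)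
qed

section \<open>Determinism and programs of length 0\<close>

lemma tm_step_deterministic: "tm_step M c d \<Longrightarrow> tm_step M c d' \<Longrightarrow> d = d'"
  by (auto elim!: tm_step.cases)

lemma tm_halting_config_unique:
  assumes "(tm_step M)\<^sup>*\<^sup>* c d" "(tm_step M)\<^sup>*\<^sup>* c d'" "\<And>e. \<not> tm_step M d e" "\<And>e. \<not> tm_step M d' e"
  shows "d = d'"
  using assms(1,2)
proof (induction rule: converse_rtranclp_induct)
  case base
  thus ?case using assms(3) by (metis converse_rtranclpE)
next
  case (step c e)
  thus ?case using assms(4) by (metis converse_rtranclpE tm_step_deterministic)
qed

text \<open>The halting configuration is unique, and the length of the output is the position of the
  first cell from 0 on without a letter. Coding words for different \<open>n\<close> differ in
  length, so one program yields the word for at most one \<open>n\<close>.\<close>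

lemma computes_length_unique:
  assumes "computes M p s" "computes M p s'"
  shows "length s = length s'"
proof -
  obtain q i t where 1: "(tm_step M)\<^sup>*\<^sup>* (initial_config p) (q, i, t)" "M (q, t i) = None"
    "\<forall>j<length s. t (int j) = Letter (s ! j)" "\<forall>a. t (int (length s)) \<noteq> Letter a"
    using assms(1) unfolding computes_def by blast
  obtain q' i' t' where 2: "(tm_step M)\<^sup>*\<^sup>* (initial_config p) (q', i', t')" "M (q', t' i') = None"
    "\<forall>j<length s'. t' (int j) = Letter (s' ! j)" "\<forall>a. t' (int (length s')) \<noteq> Letter a"
    using assms(2) unfolding computes_def by blast
  have "(q, i, t) = (q', i', t')"
    using 1(1) 2(1) by (rule tm_halting_config_unique) (use 1(2) 2(2) in \<open>auto elim!: tm_step.cases\<close>)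
  thus ?thesis using 1(3,4) 2(3,4) by (metis linorder_neqE_nat prod.inject)
qed

theorem theorem11:
  fixes r :: nat and I :: "nat \<Rightarrow> real set" and \<sigma> :: "nat \<Rightarrow> nat" and T :: "real \<Rightarrow> real"
    and M :: "nat \<Rightarrow> tm" and U :: tm
  assumes "r \<ge> 2"
    and "interval_exchange r I \<sigma> T"
    and "aperiodic T"
    and "computable_enumeration r M"
    and "universal r M U"
  shows "AE x in lebesgue_on {0..<1}.
           (\<forall>n. AIC U (coding_word r I T x n) \<noteq> \<infinity>) \<and>
           (\<exists>c>0. same_order (\<lambda>n. real (the_enat (AIC U (coding_word r I T x n)))) (\<lambda>n. c))"
proof (rule AE_I2)
  fix x :: real assume "x \<in> space (lebesgue_on {0..<1})"
  hence x: "x \<in> {0..<1}" by simp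
  obtain D A K where D: "D \<in> turing_machines r" and prog: "\<And>n.
     \<exists>p. length p \<le> A + K * nat \<lceil>log 2 (real n + 1)\<rceil> \<and> computes D p (coding_word r I T x n)"
    using coding_word_program[OF _ assms(2,3)] assms(1) x by (metis le_trans one_le_numeral)
  obtain m where m: "m \<ge> 1" "D = M m"
    using D assms(4) unfolding computable_enumeration_def by (metis atLeast_iff imageE)
  \<comment> \<open>Simulating \<open>D\<close> on \<open>U\<close> costs the fixed prefix that
    names \<open>D\<close> in the enumeration.\<close>
  define A' where "A' = A + length (hat (bin_string m))"
  define aic where "aic n = AIC U (coding_word r I T x n)" for n
  have le: "aic n \<le> enat (A' + K * nat \<lceil>log 2 (real n + 1)\<rceil>)" for n
  proof -
    obtain p where p: "length p \<le> A + K * nat \<lceil>log 2 (real n + 1)\<rceil>" "computes D p (coding_word r I T x n)"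
      using prog by blast
    have "computes U (hat (bin_string m) @ p) (coding_word r I T x n)"
      using assms(5) m p(2) unfolding universal_def by blast
    from AIC_le[OF this] have "aic n \<le> enat (length (hat (bin_string m) @ p))" by (simp add: aic_def)
    also have "\<dots> \<le> enat (A' + K * nat \<lceil>log 2 (real n + 1)\<rceil>)" using p by (simp add: A'_def)
    finally show ?thesis .
  qed
  hence fin: "aic n \<noteq> \<infinity>" for n by (metis infinity_ileE)
  define f where "f n = real (the_enat (aic n))" for n
  have f_le: "f n \<le> real A' + real K + real K * log 2 (real n + 1)" for n
  proof -
    obtain k where k: "aic n = enat k" using fin by blast
    hence "k \<le> A' + K * nat \<lceil>log 2 (real n + 1)\<rceil>" using le[of n] by simp
    hence "real k \<le> real A' + real K * real (nat \<lceil>log 2 (real n + 1)\<rceil>)"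
      by (metis of_nat_add of_nat_le_iff of_nat_mult)
    also have "real (nat \<lceil>log 2 (real n + 1)\<rceil>) \<le> log 2 (real n + 1) + 1"
      using ceiling_correct[of "log 2 (real n + 1)"] by simp
    hence "real A' + real K * real (nat \<lceil>log 2 (real n + 1)\<rceil>) \<le> real A' + real K * (log 2 (real n + 1) + 1)"
      by (intro add_left_mono mult_left_mono) auto
    finally show ?thesis by (simp add: f_def k algebra_simps)
  qed
  \<comment> \<open>The information content vanishes for at most one \<open>n\<close>; as a natural
    number it is at least 1 otherwise. This makes the quotients meaningful and bounds
    \<open>1 / f n\<close>.\<close>
  have ev: "\<forall>\<^sub>F n in sequentially. f n \<ge> 1"
  proof (cases "\<exists>n0. aic n0 = 0")
    case True
    then obtain n0 where n0: "aic n0 = 0" by blast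
    have "n = n0" if "aic n = 0" for n
      using computes_length_unique[OF AIC_eq_0 AIC_eq_0] that n0
      by (fastforce simp: aic_def coding_word_def)
    hence nz: "aic n \<noteq> 0" if "n > n0" for n using that by blast
    show ?thesis unfolding eventually_sequentially
    proof (intro exI[of _ "Suc n0"] allI impI)
      fix n assume "Suc n0 \<le> n"
      moreover obtain k where "aic n = enat k" using fin by blast
      ultimately show "1 \<le> f n" using nz[of n] by (cases k) (auto simp: f_def zero_enat_def)
    qed
  next
    case False
    show ?thesis
    proof (intro always_eventually allI)
      fix n
      obtain k where "aic n = enat k" using fin by blast
      thus "1 \<le> f n" using False by (cases k) (auto simp: f_def zero_enat_def)
    qed
  qed
  have "same_order f (\<lambda>n. 1)"
    unfolding same_order_def
  proof (intro conjI allI impI)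
    show "\<forall>\<^sub>F n in sequentially. f n \<noteq> 0 \<and> (1 :: real) \<noteq> 0"
      using ev by eventually_elim auto
    fix \<epsilon> :: real assume \<epsilon>: "\<epsilon> > 0"
    have one: "(\<lambda>n. 1) \<in> o(\<lambda>n. real n powr \<epsilon>)" 
      by (rule smalloI_tendsto) (use lim_1_over_real_power[OF \<epsilon>] eventually_gt_at_top[of 0] in
        \<open>auto elim!: eventually_mono\<close>)
    have ln: "(\<lambda>n. ln (real n)) \<in> o(\<lambda>n. real n powr \<epsilon>)"
      by (rule smalloI_tendsto) (use lim_ln_over_power[OF \<epsilon>] eventually_gt_at_top[of 0] in
        \<open>auto elim!: eventually_mono\<close>)
    have cmult: "(\<lambda>n. c * h n) \<in> o(\<lambda>n. real n powr \<epsilon>)" if "h \<in> o(\<lambda>n. real n powr \<epsilon>)"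
      for c :: real and h :: "nat \<Rightarrow> real"
      using that by (cases "c = 0") simp_all
    have log: "(\<lambda>n. log 2 (real n + 1)) \<in> o(\<lambda>n. real n powr \<epsilon>)"
    proof (rule landau_o.big_small_trans)
      have "\<bar>log 2 (real n + 1)\<bar> \<le> \<bar>1 * 1 + (1 / ln 2) * ln (real n)\<bar>" if "1 \<le> n" for n
      proof -
        \<comment> \<open>From \<open>n + 1 \<le> 2 * n\<close>. The bound is kept as a sum of
          constant multiples so that \<open>cmult\<close> applies to each term.\<close>
        have "log 2 (real n + 1) \<le> log 2 (2 * real n)" using that by (subst log_le_cancel_iff) auto
        also have "\<dots> = 1 * 1 + (1 / ln 2) * ln (real n)" using that by (simp add: log_mult) (simp add: log_def)
        finally show ?thesis using that by (smt (verit) of_nat_0_le_iff zero_le_log_cancel_iff)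
      qed
      thus "(\<lambda>n. log 2 (real n + 1)) \<in> O(\<lambda>n. 1 * 1 + (1 / ln 2) * ln (real n))"
        by (intro bigoI[of _ 1] eventually_sequentiallyI[of 1]) simp
      show "(\<lambda>n. 1 * 1 + (1 / ln 2) * ln (real n)) \<in> o(\<lambda>n. real n powr \<epsilon>)"
        by (intro sum_in_smallo cmult one ln)
    qed
    have "(\<lambda>n. (real A' + real K) * 1 + real K * log 2 (real n + 1)) \<in> o(\<lambda>n. real n powr \<epsilon>)"
      by (intro sum_in_smallo cmult one log) 
    moreover have "(\<lambda>n. f n / 1) \<in> O(\<lambda>n. (real A' + real K) * 1 + real K * log 2 (real n + 1))"
      by (intro bigoI[of _ 1] always_eventually allI) (use f_le in \<open>auto simp: f_def\<close>)
    ultimately show "(\<lambda>n. f n / 1) \<in> o(\<lambda>n. real n powr \<epsilon>)" by (rule landau_o.big_small_trans[rotated])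
    have "(\<lambda>n. 1 / f n) \<in> O(\<lambda>n. 1)"
      using ev by (intro bigoI[of _ 1]) (auto elim!: eventually_mono)
    thus "(\<lambda>n. 1 / f n) \<in> o(\<lambda>n. real n powr \<epsilon>)" using one by (rule landau_o.big_small_trans)
  qed
  thus "(\<forall>n. AIC U (coding_word r I T x n) \<noteq> \<infinity>) \<and>
           (\<exists>c>0. same_order (\<lambda>n. real (the_enat (AIC U (coding_word r I T x n)))) (\<lambda>n. c))"
    using fin unfolding f_def aic_def by (intro conjI exI[of _ 1]) auto
qed

end
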